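(* Let $z\mapsto\bar z=H(z,\varepsilon)=z+N(z)f(z)+\varepsilon G(z,\varepsilon)$ be a fast-slow map satisfying Assumptions 1 and 2 stated in the context, let $S_n\subseteq S$ be a compact, connected, normally hyperbolic submanifold of the critical manifold, fix $\varepsilon\in[0,\varepsilon_0)$, and denote by $S_{n,\varepsilon}$ a locally invariant slow manifold perturbing from $S_n$. Then for $\varepsilon_0$ sufficiently small the map restricted to $S_{n,\varepsilon}$ is given by $$\bar z|_{S_{n,\varepsilon}}=z+\varepsilon\,\Pi^{S_n}_{\mathcal N}G(z,0)+O(\varepsilon^2),\qquad z\in S_n,$$ i.e. a point $z_\varepsilon\in S_{n,\varepsilon}$ corresponding to a base point $z\in S_n$ is mapped to $\bar z_\varepsilon=z_\varepsilon+\varepsilon\,\Pi^{S_n}_{\mathcal N}(z)G(z,0)+O(\varepsilon^2)$. Moreover, the unique projection operator $\Pi^{S_n}_{\mathcal N}$ has matrix representation $$\Pi^{S_n}_{\mathcal N}=I_n-N(Df\,N)^{-1}Df|_{S_n}.$$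
   Context: Setting: $1\le k<n$, $z\in\mathbb R^n$, $\varepsilon\in[0,\varepsilon_0)$, $H$ is $C^r$-smooth with $r$ large enough for the expansions used, $N(z)$ is an $n\times(n-k)$ matrix, $f(z)\in\mathbb R^{n-k}$, $G(z,\varepsilon)\in\mathbb R^n$. Assumption 1 (fast-slow map): the level set $\{z:N(z)f(z)=0\}$ contains a connected $k$-dimensional regularly embedded submanifold $S$ of $\mathbb R^n$. Assumption 2 (factorisation): $N(z)$ has full column rank for all $z\in S$, $S=\{f=0\}$ (the critical manifold), and any zeros $z_\ast\notin S$ of $N(z)f(z)$ are isolated. Normal hyperbolicity of $S_n$: for $z\in S_n$, $DH(z,0)=I_n+N(z)Df(z)$ has $k$ eigenvalues $1$ with eigenvectors spanning $T_zS$; the remaining $n-k$ eigenvalues $\mu_j(z)$ satisfy $|\mu_j(z)|\ne1$. Projection: with $\mathcal N_z$ the span of the columns of $N(z)$, normal hyperbolicity gives the splitting $T_z\mathbb R^n=T_zS_n\oplus\mathcal N_z$ for $z\in S_n$, and bundles $TS_n=\bigcup_zT_zS_n$, $\mathcal N=\bigcup_z\mathcal N_z$. $\Pi^{S_n}_{\mathcal N}:TS_n\oplus\mathcal N\to TS_n$ is the unique projection onto $TS_n$ along $\mathcal N$. Slow manifold: $S_{n,\varepsilon}$ is a compact connected manifold that is $O(\varepsilon)$-close and diffeomorphic to $S_n$, $C^r$-smooth in $z$ and $\varepsilon$, on which $H$ is invertible and which is locally invariant under $H$. In local coordinates $z=(x,y)\in\mathbb R^k\times\mathbb R^{n-k}$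 with $D_yf$ invertible, $S_n$ and $S_{n,\varepsilon}$ are graphs $y=\varphi_0(x)$ and $y=\varphi_\varepsilon(x)$ with $\varphi_\varepsilon=\varphi_0+O(\varepsilon)$, and the point $z_\varepsilon=(x,\varphi_\varepsilon(x))$ corresponds to the base point $z=(x,\varphi_0(x))$. *)

theory Defs
  imports "HOL-Analysis.Analysis"
begin

text \<open>
  Dimensions: \<open>'n\<close> indexes \<open>\<real>\<^sup>n\<close>, \<open>'k\<close> indexes \<open>\<real>\<^sup>k\<close> and \<open>'m\<close> indexes \<open>\<real>\<^bsup>n-k\<^esup>\<close>; the theorem
  assumes \<open>CARD('n) = CARD('k) + CARD('m)\<close>, and \<open>1 \<le> k < n\<close> holds because index types are
  nonempty.
\<close>


section \<open>Finite smoothness\<close>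

text \<open>\<open>C_diff r g U\<close> is meant for open \<open>U\<close>: all iterated directional derivatives of order at most
  \<open>r\<close> exist and are continuous.\<close>

primrec C_diff :: "nat \<Rightarrow> ('a::euclidean_space \<Rightarrow> 'b::real_normed_vector) \<Rightarrow> 'a set \<Rightarrow> bool" where
  "C_diff 0 g U = continuous_on U g"
| "C_diff (Suc r) g U =
     ((\<forall>x\<in>U. g differentiable (at x)) \<and> (\<forall>v. C_diff r (\<lambda>x. frechet_derivative g (at x) v) U))"

text \<open>Smoothness on an arbitrary set (manifolds, half-open parameter intervals): existence of local
  extensions to open sets.\<close>

definition C_diff_on :: "nat \<Rightarrow> ('a::euclidean_space \<Rightarrow> 'b::real_normed_vector) \<Rightarrow> 'a set \<Rightarrow> bool" where
  "C_diff_on r g A \<longleftrightarrow>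
     (\<forall>x\<in>A. \<exists>U h. open U \<and> x \<in> U \<and> C_diff r h U \<and> (\<forall>y\<in>A \<inter> U. h y = g y))"


section \<open>Submanifolds and tangent spaces\<close>

definition local_diffeo_chart ::
  "nat \<Rightarrow> 'a::euclidean_space set \<Rightarrow> 'a set \<Rightarrow> ('a \<Rightarrow> 'a) \<Rightarrow> ('a \<Rightarrow> 'a) \<Rightarrow> bool" where
  "local_diffeo_chart r U V \<psi> \<theta> \<longleftrightarrow>
     open U \<and> open V \<and> homeomorphism U V \<psi> \<theta> \<and> C_diff r \<psi> U \<and> C_diff r \<theta> V"

definition embedded_submanifold :: "nat \<Rightarrow> nat \<Rightarrow> 'a::euclidean_space set \<Rightarrow> bool" where
  "embedded_submanifold r d S \<longleftrightarrow>
     (\<forall>p\<in>S. \<exists>U V \<psi> \<theta> L. p \<in> U \<and> local_diffeo_chart r U V \<psi> \<theta> \<and>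
        subspace L \<and> dim L = d \<and> \<psi> ` (S \<inter> U) = L \<inter> V)"

text \<open>Submanifold with possibly empty boundary. A chart with \<open>b = 0\<close> is an interior chart (the model
  is all of \<open>L\<close>); for \<open>b \<noteq> 0\<close> the model is a closed half-space of \<open>L\<close>.\<close>

definition embedded_submanifold_bd :: "nat \<Rightarrow> nat \<Rightarrow> 'a::euclidean_space set \<Rightarrow> bool" where
  "embedded_submanifold_bd r d A \<longleftrightarrow>
     (\<forall>p\<in>A. \<exists>U V \<psi> \<theta> L b. p \<in> U \<and> local_diffeo_chart r U V \<psi> \<theta> \<and>
        subspace L \<and> dim L = d \<and> b \<in> L \<and> \<psi> ` (A \<inter> U) = {v \<in> L. 0 \<le> b \<bullet> v} \<inter> V)"

text \<open>Velocities of \<open>C\<^sup>1\<close> curves in the boundaryless manifold \<open>S\<close>. A \<open>k\<close>-dimensional submanifold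
  \<open>S\<^sub>n \<subseteq> S\<close> has \<open>T\<^sub>z S\<^sub>n = T\<^sub>z S\<close> at each of its points (boundary points included), so
  \<open>tangent_space S z\<close> is used for both.\<close>

definition tangent_space :: "'a::euclidean_space set \<Rightarrow> 'a \<Rightarrow> 'a set" where
  "tangent_space S z =
     {v. \<exists>(\<gamma> :: real \<Rightarrow> 'a) \<delta>. 0 < \<delta> \<and> C_diff 1 \<gamma> {-\<delta><..<\<delta>} \<and> \<gamma> ` {-\<delta><..<\<delta>} \<subseteq> S \<and>
           \<gamma> 0 = z \<and> (\<gamma> has_vector_derivative v) (at 0)}"


section \<open>Fast-slow maps\<close>

definition fs_map ::
  "(real^'n \<Rightarrow> real^'m^'n) \<Rightarrow> (real^'n \<Rightarrow> real^'m) \<Rightarrow> (real^'n \<Rightarrow> real \<Rightarrow> real^'n)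
    \<Rightarrow> real^'n \<Rightarrow> real \<Rightarrow> real^'n" where
  "fs_map N f G z \<epsilon> = z + N z *v f z + \<epsilon> *\<^sub>R G z \<epsilon>"

definition fs_smooth ::
  "nat \<Rightarrow> real \<Rightarrow> (real^'n \<Rightarrow> real^'m^'n) \<Rightarrow> (real^'n \<Rightarrow> real^'m) \<Rightarrow> (real^'n \<Rightarrow> real \<Rightarrow> real^'n)
    \<Rightarrow> bool" where
  "fs_smooth r \<epsilon>0 N f G \<longleftrightarrow>
     C_diff_on r (\<lambda>(z, \<epsilon>). fs_map N f G z \<epsilon>) (UNIV \<times> {0..<\<epsilon>0}) \<and>
     C_diff r N UNIV \<and> C_diff r f UNIV \<and>
     continuous_on (UNIV \<times> {0..<\<epsilon>0}) (\<lambda>(z, \<epsilon>). G z \<epsilon>)"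

definition assumption_fast_slow ::
  "nat \<Rightarrow> nat \<Rightarrow> (real^'n \<Rightarrow> real^'m^'n) \<Rightarrow> (real^'n \<Rightarrow> real^'m) \<Rightarrow> (real^'n) set \<Rightarrow> bool" where
  "assumption_fast_slow r k N f S \<longleftrightarrow>
     S \<subseteq> {z. N z *v f z = 0} \<and> connected S \<and> embedded_submanifold r k S"

definition assumption_factorisation ::
  "(real^'n \<Rightarrow> real^'m^'n) \<Rightarrow> (real^'n \<Rightarrow> real^'m) \<Rightarrow> (real^'n) set \<Rightarrow> bool" where
  "assumption_factorisation N f S \<longleftrightarrow>
     (\<forall>z\<in>S. rank (N z) = CARD('m)) \<and>
     S = {z. f z = 0} \<and>
     (\<forall>z. N z *v f z = 0 \<and> z \<notin> S \<longrightarrow> z isolated_in {w. N w *v f w = 0})"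

text \<open>The eigenvalues, with algebraic multiplicity, are read off from the factorisation of the
  characteristic polynomial over \<open>\<complex>\<close>; the eigenspace for the eigenvalue \<open>1\<close> is \<open>T\<^sub>z S\<close>.\<close>

definition normally_hyperbolic ::
  "nat \<Rightarrow> (real^'n \<Rightarrow> real \<Rightarrow> real^'n) \<Rightarrow> (real^'n) set \<Rightarrow> (real^'n) set \<Rightarrow> bool" where
  "normally_hyperbolic k H S Sn \<longleftrightarrow>
     (\<forall>z\<in>Sn. let A = jacobian (\<lambda>w. H w 0) (at z) in
        {v. A *v v = v} = tangent_space S z \<and>
        (\<exists>\<mu> :: nat \<Rightarrow> complex.
           (\<forall>j < CARD('n) - k. cmod (\<mu> j) \<noteq> 1) \<and>
           (\<forall>x. det (mat x - (\<chi> i j. complex_of_real (A $ i $ j)) :: complex^'n^'n)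
                = (x - 1) ^ k * (\<Prod>j < CARD('n) - k. x - \<mu> j))))"


section \<open>Slow manifolds\<close>

text \<open>
  An orbit may leave \<open>M \<epsilon>\<close> only through its boundary. The condition is therefore imposed near
  points of the manifold interior of \<open>S\<^sub>n\<close>, which is its topological interior relative to \<open>S\<close>, and the
  neighbourhoods do not shrink with \<open>\<epsilon>\<close> (with neighbourhoods of \<open>M \<epsilon>\<close> that are allowed to shrink
  arbitrarily fast the condition would be void). It follows from the more familiar condition
  \<open>z \<in> M \<epsilon> \<Longrightarrow> H z \<epsilon> \<in> V \<Longrightarrow> H z \<epsilon> \<in> M \<epsilon>\<close> for one open set \<open>V\<close> containing that interior.
\<close>

definition locally_invariant ::
  "('a::euclidean_space \<Rightarrow> real \<Rightarrow> 'a) \<Rightarrow> 'a set \<Rightarrow> 'a set \<Rightarrow> real \<Rightarrow> (real \<Rightarrow> 'a set) \<Rightarrow> bool" where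
  "locally_invariant H S Sn \<epsilon>0 M \<longleftrightarrow>
     (\<forall>p \<in> top_of_set S interior_of Sn. \<exists>\<delta>>0. \<forall>\<epsilon>\<in>{0..<\<epsilon>0}. \<epsilon> < \<delta> \<longrightarrow>
        (\<forall>z \<in> M \<epsilon>. dist (H z \<epsilon>) p < \<delta> \<longrightarrow> H z \<epsilon> \<in> M \<epsilon>))"

text \<open>
  \<open>M \<epsilon>\<close> is the slow manifold and \<open>\<Phi> z \<epsilon> \<in> M \<epsilon>\<close> the point corresponding to the base point \<open>z \<in> S\<^sub>n\<close>.
  \<open>\<Phi>\<close> carries the smoothness in \<open>(z, \<epsilon>)\<close>, the \<open>O(\<epsilon>)\<close>-closeness and the diffeomorphism \<open>S\<^sub>n \<cong> M \<epsilon>\<close>;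
  through the latter \<open>M \<epsilon>\<close> inherits being a compact connected manifold from \<open>S\<^sub>n\<close>.
\<close>

definition slow_manifold ::
  "nat \<Rightarrow> ('a::euclidean_space \<Rightarrow> real \<Rightarrow> 'a) \<Rightarrow> 'a set \<Rightarrow> 'a set \<Rightarrow> real
    \<Rightarrow> ('a \<Rightarrow> real \<Rightarrow> 'a) \<Rightarrow> (real \<Rightarrow> 'a set) \<Rightarrow> bool" where
  "slow_manifold r H S Sn \<epsilon>0 \<Phi> M \<longleftrightarrow>
     C_diff_on r (\<lambda>(z, \<epsilon>). \<Phi> z \<epsilon>) (Sn \<times> {0..<\<epsilon>0}) \<and>
     (\<forall>z\<in>Sn. \<Phi> z 0 = z) \<and>
     (\<exists>K. \<forall>\<epsilon>\<in>{0..<\<epsilon>0}. \<forall>z\<in>Sn. norm (\<Phi> z \<epsilon> - z) \<le> K * \<epsilon>) \<and>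
     (\<forall>\<epsilon>\<in>{0..<\<epsilon>0}.
        M \<epsilon> = (\<lambda>z. \<Phi> z \<epsilon>) ` Sn \<and> inj_on (\<lambda>z. \<Phi> z \<epsilon>) Sn \<and>
        C_diff_on r (inv_into Sn (\<lambda>z. \<Phi> z \<epsilon>)) (M \<epsilon>) \<and>
        inj_on (\<lambda>z. H z \<epsilon>) (M \<epsilon>)) \<and>
     locally_invariant H S Sn \<epsilon>0 M"

text \<open>
  Local coordinates \<open>L z = (x, y) \<in> \<real>\<^sup>k \<times> \<real>\<^bsup>n-k\<^esup>\<close> (a linear change of coordinates, for instance a
  reordering of the components) in which, inside the open set \<open>W\<close>, \<open>S\<^sub>n\<close> and \<open>M \<epsilon>\<close> are the graphs of
  \<open>\<phi> 0\<close> and \<open>\<phi> \<epsilon>\<close> over \<open>D\<close>, with \<open>D\<^sub>y f\<close> invertible.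
\<close>

definition graph_coordinates ::
  "(real^'n \<Rightarrow> real^'m) \<Rightarrow> (real^'n) set \<Rightarrow> (real \<Rightarrow> (real^'n) set) \<Rightarrow> real
    \<Rightarrow> (real^'n \<Rightarrow> (real^'k) \<times> (real^'m)) \<Rightarrow> (real^'n) set \<Rightarrow> (real^'k) set
    \<Rightarrow> (real \<Rightarrow> real^'k \<Rightarrow> real^'m) \<Rightarrow> bool" where
  "graph_coordinates f Sn M \<delta> L W D \<phi> \<longleftrightarrow>
     linear L \<and> bij L \<and> open W \<and>
     L ` (Sn \<inter> W) = {(x, \<phi> 0 x) | x. x \<in> D} \<and>
     (\<forall>\<epsilon>\<in>{0..<\<delta>}. L ` (M \<epsilon> \<inter> W) = {(x, \<phi> \<epsilon> x) | x. x \<in> D}) \<and>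
     (\<forall>z \<in> Sn \<inter> W. bij (\<lambda>y. frechet_derivative f (at z) (inv L (0, y)))) \<and>
     (\<exists>K. \<forall>\<epsilon>\<in>{0..<\<delta>}. \<forall>x\<in>D. norm (\<phi> \<epsilon> x - \<phi> 0 x) \<le> K * \<epsilon>)"


section \<open>The projection along the fast fibres\<close>

definition is_projection_onto_along ::
  "'a::real_vector set \<Rightarrow> 'a set \<Rightarrow> ('a \<Rightarrow> 'a) \<Rightarrow> bool" where
  "is_projection_onto_along T F P \<longleftrightarrow>
     linear P \<and> P \<circ> P = P \<and> range P = T \<and> {v. P v = 0} = F"

abbreviation fast_fibre :: "(real^'n \<Rightarrow> real^'m^'n) \<Rightarrow> real^'n \<Rightarrow> (real^'n) set" where
  "fast_fibre N z \<equiv> span (columns (N z))"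

definition slow_projection ::
  "(real^'n \<Rightarrow> real^'m^'n) \<Rightarrow> (real^'n) set \<Rightarrow> real^'n \<Rightarrow> real^'n \<Rightarrow> real^'n" where
  "slow_projection N S z = (THE P. is_projection_onto_along (tangent_space S z) (fast_fibre N z) P)"

end

theory Submission
  imports Defs
begin

text \<open>
  Near a base point the slow manifold is \<open>\<Phi> z \<epsilon> = z + \<epsilon> s(z) + O(\<epsilon>\<^sup>2)\<close>, because \<open>\<Phi>\<close> extends to a
  \<open>C\<^sup>2\<close> map with \<open>\<Phi> z 0 = z\<close>. Expanding \<open>H\<close> to first order around the fixed point \<open>z\<close> gives
  \<open>H (\<Phi> z \<epsilon>) \<epsilon> = \<Phi> z \<epsilon> + \<epsilon> v(z) + O(\<epsilon>\<^sup>2)\<close> with the drift \<open>v = N Df s + G(\<cdot>, 0)\<close>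
  (lemma \<open>expansions\<close>). It remains to identify \<open>v(z)\<close> with the projection of \<open>G(z, 0)\<close>. Since \<open>v\<close> and
  \<open>G(\<cdot>, 0)\<close> differ by an element of the fast fibre, this amounts to \<open>v(z)\<close> being tangent to \<open>S\<close>, that
  is, to \<open>Df(z) v(z) = 0\<close>.

  Tangency comes from local invariance. If \<open>z\<close> lies in the interior of \<open>S\<^sub>n\<close> relative to \<open>S\<close>, the image
  of \<open>\<Phi> z \<epsilon>\<close> lies on the slow manifold again, hence has a base point \<open>w\<close>, and comparing the
  expansions at \<open>z\<close> and at \<open>w\<close> yields \<open>w = z + \<epsilon> v(z) + O(\<epsilon>\<^sup>2)\<close>. Both \<open>z\<close> and \<open>w\<close> are zeros of \<open>f\<close>, so
  \<open>Df(z) v(z)\<close> vanishes (lemma \<open>tangent_first_order_motion\<close>). Interior points are dense in \<open>S\<^sub>n\<close>, by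
  invariance of domain (lemma \<open>rel_interior_dense_in_submanifold_bd\<close>), and \<open>v\<close> is locally Lipschitz, so
  the equation extends to all of \<open>S\<^sub>n\<close>. Compactness of \<open>S\<^sub>n\<close> makes the constants uniform. In graph
  coordinates the point \<open>z\<^sub>\<epsilon>\<close> over \<open>x\<close> is \<open>\<Phi> w \<epsilon>\<close> for a base point \<open>w\<close> that need not be \<open>z\<close> but is
  \<open>O(\<epsilon>)\<close>-close to it, and the Lipschitz estimate for \<open>v\<close> absorbs the difference.

  The projection exists because \<open>Df N\<close> is invertible. Otherwise \<open>B = N Df\<close> would satisfy
  \<open>rank (B\<^sup>2) = rank (N (Df N) Df) < n - k\<close>, which forces the characteristic polynomial of \<open>B\<^sup>2\<close> to
  vanish at \<open>0\<close> to order more than \<open>k\<close>; normal hyperbolicity says that this order is exactly \<open>k\<close>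
  (lemma \<open>invertible_if_char_poly_order\<close>). Given invertibility, \<open>I - N (Df N)\<^bsup>-1\<^esup> Df\<close> has kernel the
  column span of \<open>N\<close> and range \<open>ker Df\<close>, which is the tangent space.
\<close>

section \<open>Local bounds for functions with two continuous derivatives\<close>

lemma C_diff_Suc_imp: "C_diff (Suc r) g U \<Longrightarrow> C_diff r g U"
proof (induction r arbitrary: g)
  case 0
  then show ?case
    by (auto intro!: continuous_at_imp_continuous_on differentiable_imp_continuous_within)
qed auto

lemma C_diff_le: "C_diff r g U \<Longrightarrow> s \<le> r \<Longrightarrow> C_diff s g U"
  by (induction r) (auto simp del: C_diff.simps simp: le_Suc_eq dest: C_diff_Suc_imp)

lemma C_diff_has_derivative:
  assumes "C_diff r g U" "1 \<le> r" "x \<in> U"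
  shows "(g has_derivative frechet_derivative g (at x)) (at x)"
  using C_diff_le[OF assms(1,2)] assms(3) by (simp add: frechet_derivative_works)

text \<open>
  \<open>C_diff\<close> speaks about directional derivatives one direction at a time; this bound turns estimates
  in the finitely many basis directions into operator norm estimates.
\<close>

lemma norm_linear_le_sum_Basis:
  fixes A :: "'a::euclidean_space \<Rightarrow> 'b::real_normed_vector"
  assumes "linear A" "\<And>i. i \<in> Basis \<Longrightarrow> norm (A i) \<le> c i"
  shows "norm (A v) \<le> (\<Sum>i\<in>Basis. c i) * norm v"
proof -
  have "A v = A (\<Sum>i\<in>Basis. (v \<bullet> i) *\<^sub>R i)"
    by (simp add: euclidean_representation)
  also have "\<dots> = (\<Sum>i\<in>Basis. (v \<bullet> i) *\<^sub>R A i)"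
    by (simp add: linear_sum[OF assms(1)] linear_cmul[OF assms(1)])
  also have "norm \<dots> \<le> (\<Sum>i\<in>Basis. c i * norm v)"
  proof (rule sum_norm_le)
    fix i :: 'a assume i: "i \<in> Basis"
    have "\<bar>v \<bullet> i\<bar> * norm (A i) \<le> norm v * c i"
      using i assms(2)[OF i] by (intro mult_mono) (auto simp: Basis_le_norm)
    then show "norm ((v \<bullet> i) *\<^sub>R A i) \<le> c i * norm v"
      by (simp add: mult.commute)
  qed
  finally show ?thesis
    by (simp add: sum_distrib_right)
qed

lemma C_diff_1_derivative_locally_bounded:
  fixes g :: "'a::euclidean_space \<Rightarrow> 'b::real_normed_vector"
  assumes "C_diff 1 g U" "open U" "p \<in> U"
  obtains \<delta> C where "0 < \<delta>" "0 \<le> C" "ball p \<delta> \<subseteq> U"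
    "\<And>x v. x \<in> ball p \<delta> \<Longrightarrow> norm (frechet_derivative g (at x) v) \<le> C * norm v"
proof -
  let ?D = "\<lambda>x. frechet_derivative g (at x)"
  have "\<forall>\<^sub>F x in nhds p. \<forall>i\<in>Basis. norm (?D x i) < norm (?D p i) + 1"
  proof (rule eventually_ball_finite[OF finite_Basis], rule ballI)
    fix i :: 'a
    have "continuous_on U (\<lambda>x. norm (?D x i))"
      using assms(1) by (auto intro!: continuous_intros)
    then have "isCont (\<lambda>x. norm (?D x i)) p"
      using assms(2,3) continuous_on_eq_continuous_at by blast
    then have "((\<lambda>x. norm (?D x i)) \<longlongrightarrow> norm (?D p i)) (nhds p)"
      unfolding isCont_def by (rule tendsto_at_iff_tendsto_nhds[THEN iffD1])
    then show "\<forall>\<^sub>F x in nhds p. norm (?D x i) < norm (?D p i) + 1"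
      by (rule order_tendstoD) simp
  qed
  moreover have "\<forall>\<^sub>F x in nhds p. x \<in> U"
    using assms by (auto simp: eventually_nhds)
  ultimately have "\<forall>\<^sub>F x in nhds p. (\<forall>i\<in>Basis. norm (?D x i) < norm (?D p i) + 1) \<and> x \<in> U"
    by (rule eventually_conj)
  then obtain \<delta> where \<delta>: "0 < \<delta>"
    "\<And>x. dist x p < \<delta> \<Longrightarrow> (\<forall>i\<in>Basis. norm (?D x i) < norm (?D p i) + 1) \<and> x \<in> U"
    unfolding eventually_nhds_metric by blast
  show thesis
  proof (rule that[of \<delta> "\<Sum>i\<in>Basis. norm (?D p i) + 1"])
    show "0 \<le> (\<Sum>i\<in>Basis. norm (?D p i) + 1)"
      by (intro sum_nonneg) (auto intro: add_nonneg_nonneg)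
    show "ball p \<delta> \<subseteq> U"
      using \<delta>(2) by (auto simp: dist_commute)
    fix x v assume x: "x \<in> ball p \<delta>"
    have "linear (?D x)"
      using assms(1) x \<delta>(2)[of x] by (intro linear_frechet_derivative) (simp add: dist_commute)
    then show "norm (?D x v) \<le> (\<Sum>i\<in>Basis. norm (?D p i) + 1) * norm v"
    proof (rule norm_linear_le_sum_Basis)
      fix i :: 'a assume "i \<in> Basis"
      then show "norm (?D x i) \<le> norm (?D p i) + 1"
        using \<delta>(2)[of x] x by (intro less_imp_le) (simp add: dist_commute)
    qed
  qed (use \<delta> in auto)
qed

lemma C_diff_1_locally_Lipschitz:
  fixes g :: "'a::euclidean_space \<Rightarrow> 'b::real_normed_vector"
  assumes "C_diff 1 g U" "open U" "p \<in> U"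
  obtains \<delta> C where "0 < \<delta>" "0 \<le> C"
    "\<And>x y. x \<in> ball p \<delta> \<Longrightarrow> y \<in> ball p \<delta> \<Longrightarrow> norm (g x - g y) \<le> C * norm (x - y)"
proof -
  obtain \<delta> C where d: "0 < \<delta>" "0 \<le> C" "ball p \<delta> \<subseteq> U"
    and b: "\<And>x v. x \<in> ball p \<delta> \<Longrightarrow> norm (frechet_derivative g (at x) v) \<le> C * norm v"
    using C_diff_1_derivative_locally_bounded[OF assms] by blast
  show thesis
  proof (rule that[OF d(1,2)])
    fix x y assume "x \<in> ball p \<delta>" "y \<in> ball p \<delta>"
    then show "norm (g x - g y) \<le> C * norm (x - y)"
    proof (rule differentiable_bound[OF convex_ball, rotated 2])
      fix z assume z: "z \<in> ball p \<delta>"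
      show "(g has_derivative frechet_derivative g (at z)) (at z within ball p \<delta>)"
        by (rule has_derivative_at_withinI[OF C_diff_has_derivative[OF assms(1) order_refl subsetD[OF d(3) z]]])
      show "onorm (frechet_derivative g (at z)) \<le> C"
        using b[OF z] by (rule onorm_le)
    qed
  qed
qed

text \<open>
  The only consequences of smoothness that the expansions use: near a point, a \<open>C\<^sup>2\<close> function has a
  bounded and Lipschitz continuous derivative and a quadratic Taylor remainder, all with one constant
  that is valid for every pair of points of a ball and not just at its centre.
\<close>

lemma C_diff_2_local_bounds:
  fixes g :: "'a::euclidean_space \<Rightarrow> 'b::real_normed_vector"
  assumes "C_diff 2 g U" "open U" "p \<in> U"
  obtains \<delta> C where "0 < \<delta>" "0 \<le> C" "ball p \<delta> \<subseteq> U"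
    "\<And>x v. x \<in> ball p \<delta> \<Longrightarrow> norm (frechet_derivative g (at x) v) \<le> C * norm v"
    "\<And>x y v. x \<in> ball p \<delta> \<Longrightarrow> y \<in> ball p \<delta> \<Longrightarrow>
       norm (frechet_derivative g (at x) v - frechet_derivative g (at y) v) \<le> C * norm (x - y) * norm v"
    "\<And>x y. x \<in> ball p \<delta> \<Longrightarrow> y \<in> ball p \<delta> \<Longrightarrow>
       norm (g y - g x - frechet_derivative g (at x) (y - x)) \<le> C * (norm (y - x))\<^sup>2"
proof -
  let ?D = "\<lambda>x. frechet_derivative g (at x)"
  have C1: "C_diff 1 g U"
    using assms(1) by (rule C_diff_le) simp
  have C1D: "C_diff 1 (\<lambda>x. ?D x v) U" for v
    using assms(1) by (simp add: numeral_2_eq_2)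
  obtain \<delta>0 C0 where d0: "0 < \<delta>0" "0 \<le> C0" "ball p \<delta>0 \<subseteq> U"
    and b0: "\<And>x v. x \<in> ball p \<delta>0 \<Longrightarrow> norm (?D x v) \<le> C0 * norm v"
    using C_diff_1_derivative_locally_bounded[OF C1 assms(2,3)] by blast
  have "\<exists>\<delta> C. 0 < \<delta> \<and> 0 \<le> C \<and> (\<forall>x\<in>ball p \<delta>. \<forall>y\<in>ball p \<delta>. norm (?D x i - ?D y i) \<le> C * norm (x - y))" for i
    using C_diff_1_locally_Lipschitz[OF C1D assms(2,3), of i] by metis
  then obtain d c where dc: "\<And>i. 0 < d i" "\<And>i. 0 \<le> c i"
    "\<And>i x y. x \<in> ball p (d i) \<Longrightarrow> y \<in> ball p (d i) \<Longrightarrow> norm (?D x i - ?D y i) \<le> c i * norm (x - y)"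
    by metis
  define \<delta> where "\<delta> = min \<delta>0 (Min (d ` (Basis :: 'a set)))"
  define C where "C = C0 + (\<Sum>i\<in>Basis. c i)"
  have S0: "0 \<le> (\<Sum>i\<in>Basis. c i)"
    by (intro sum_nonneg dc(2))
  have \<delta>: "0 < \<delta>" "\<delta> \<le> \<delta>0" "\<And>i. i \<in> Basis \<Longrightarrow> \<delta> \<le> d i"
    using d0(1) dc(1) by (auto simp: \<delta>_def min.coboundedI2)
  have sub_U: "ball p \<delta> \<subseteq> U"
    using \<delta>(2) d0(3) by auto
  have lin: "linear (?D x)" if "x \<in> ball p \<delta>" for x
    using C_diff_has_derivative[OF C1 order_refl subsetD[OF sub_U that]]
    by (rule has_derivative_linear)
  have lip: "norm (?D x v - ?D y v) \<le> C * norm (x - y) * norm v" if "x \<in> ball p \<delta>" "y \<in> ball p \<delta>" for x y v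
  proof -
    have "norm (?D x v - ?D y v) \<le> (\<Sum>i\<in>Basis. c i * norm (x - y)) * norm v"
    proof (rule norm_linear_le_sum_Basis)
      show "linear (\<lambda>v. ?D x v - ?D y v)"
        using that by (intro linear_compose_sub lin)
      fix i :: 'a assume "i \<in> Basis"
      then have "x \<in> ball p (d i)" "y \<in> ball p (d i)"
        using that \<delta>(3)[of i] by auto
      then show "norm (?D x i - ?D y i) \<le> c i * norm (x - y)"
        by (rule dc(3))
    qed
    also have "\<dots> \<le> C * norm (x - y) * norm v"
      unfolding C_def sum_distrib_right[symmetric] using d0(2) by (intro mult_right_mono) auto
    finally show ?thesis .
  qed
  show thesis
  proof (rule that[OF \<delta>(1)])
    show "0 \<le> C"
      using S0 d0(2) by (simp add: C_def)
    show "norm (?D x v) \<le> C * norm v" if "x \<in> ball p \<delta>" for x v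
    proof -
      have "norm (?D x v) \<le> C0 * norm v"
        using b0 that \<delta>(2) by auto
      also have "\<dots> \<le> C * norm v"
        using S0 by (intro mult_right_mono) (auto simp: C_def)
      finally show ?thesis .
    qed
    show "norm (g y - g x - ?D x (y - x)) \<le> C * (norm (y - x))\<^sup>2" if xy: "x \<in> ball p \<delta>" "y \<in> ball p \<delta>" for x y
    proof -
      have sub: "closed_segment x y \<subseteq> ball p \<delta>"
        using xy by (simp add: closed_segment_subset)
      have "norm (g y - g x - ?D x (y - x)) \<le> norm (y - x) * (C * norm (y - x))"
      proof (rule differentiable_bound_linearization[where S = "closed_segment x y"])
        fix t :: real assume "t \<in> {0..1}"
        then show "x + t *\<^sub>R (y - x) \<in> closed_segment x y"
          unfolding closed_segment_def by (auto simp: algebra_simps intro!: exI[of _ t])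
      next
        fix z assume z: "z \<in> closed_segment x y"
        show "(g has_derivative ?D z) (at z within closed_segment x y)"
          using z sub sub_U by (blast intro: has_derivative_at_withinI C_diff_has_derivative[OF C1 order_refl])
        show "onorm (?D z - ?D x) \<le> C * norm (y - x)"
        proof (rule onorm_le)
          fix v :: 'a
          have "norm (z - x) \<le> norm (y - x)"
            using z segment_bound1 by blast
          then have "C * norm (z - x) * norm v \<le> C * norm (y - x) * norm v"
            using \<open>0 \<le> C\<close> by (intro mult_mono mult_nonneg_nonneg) auto
          then show "norm ((?D z - ?D x) v) \<le> C * norm (y - x) * norm v"
            using lip[of z x v] z sub xy by force
        qed
      qed simp
      then show ?thesis
        by (simp add: power2_eq_square ac_simps)
    qed
  qed (fact sub_U lip)+
qed

section \<open>Relative interior of a submanifold with boundary of full dimension\<close>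

text \<open>
  \<open>A\<close> and \<open>S\<close> have the same dimension. A point of \<open>A\<close> can be pushed, in a chart of \<open>A\<close>, into the open
  half-space; there \<open>A\<close> is locally the injective continuous image of an open piece of a
  \<open>d\<close>-dimensional space inside the \<open>d\<close>-dimensional manifold \<open>S\<close>, hence open in \<open>S\<close> by invariance
  of domain.
\<close>

lemma rel_interior_dense_in_submanifold_bd:
  fixes S A :: "'a::euclidean_space set"
  assumes S: "embedded_submanifold r d S" and A: "embedded_submanifold_bd r d A" and "A \<subseteq> S"
    and p: "p \<in> A" and "0 < e"
  obtains q where "q \<in> A" "dist q p < e" "q \<in> top_of_set S interior_of A"
proof -
  obtain U V \<psi> \<theta> L b where pU: "p \<in> U" and ch: "local_diffeo_chart r U V \<psi> \<theta>"
    and L: "subspace L" "dim L = d" "b \<in> L" and im: "\<psi> ` (A \<inter> U) = {v \<in> L. 0 \<le> b \<bullet> v} \<inter> V"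
    using bspec[OF A[unfolded embedded_submanifold_bd_def] p] by (elim exE conjE) (rule that)
  have UV: "open U" "open V" and hom: "homeomorphism U V \<psi> \<theta>"
    using ch by (auto simp: local_diffeo_chart_def)
  have \<theta>\<psi>: "\<And>x. x \<in> U \<Longrightarrow> \<theta> (\<psi> x) = x" and cont\<theta>: "continuous_on V \<theta>"
    and \<psi>\<theta>: "\<And>y. y \<in> V \<Longrightarrow> \<psi> (\<theta> y) = y"
    using hom by (auto simp: homeomorphism_def)
  \<comment> \<open>The interior part of the model; for \<open>b = 0\<close> the chart is an interior chart and nothing is removed.\<close>
  define B where "B = {v \<in> L. 0 < b \<bullet> v \<or> b = 0} \<inter> V"
  have B: "\<theta> y \<in> A \<inter> U" if "y \<in> B" for y
  proof -
    have "y \<in> \<psi> ` (A \<inter> U)"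
      using that unfolding im B_def by auto
    then show ?thesis
      using \<theta>\<psi> by auto
  qed
  have x: "\<psi> p \<in> L" "0 \<le> b \<bullet> \<psi> p" "\<psi> p \<in> V"
    using im p pU by blast+
  \<comment> \<open>Moving from \<open>\<psi> p\<close> in the direction \<open>b\<close> leads into the open half-space.\<close>
  have "\<forall>\<^sub>F y in nhds (\<psi> p). y \<in> V \<and> dist (\<theta> y) p < e"
  proof (rule eventually_conj)
    show "\<forall>\<^sub>F y in nhds (\<psi> p). y \<in> V"
      using x(3) UV(2) by (auto simp: eventually_nhds)
    have "isCont \<theta> (\<psi> p)"
      using cont\<theta> UV(2) x(3) continuous_on_eq_continuous_at by blast
    then have "(\<theta> \<longlongrightarrow> \<theta> (\<psi> p)) (nhds (\<psi> p))"
      unfolding isCont_def by (rule tendsto_at_iff_tendsto_nhds[THEN iffD1])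
    then show "\<forall>\<^sub>F y in nhds (\<psi> p). dist (\<theta> y) p < e"
      using tendstoD[OF _ \<open>0 < e\<close>] \<theta>\<psi>[OF pU] by metis
  qed
  moreover have "((\<lambda>t. \<psi> p + t *\<^sub>R b) \<longlongrightarrow> \<psi> p) (at_right 0)"
    by (auto intro!: tendsto_eq_intros)
  ultimately have "\<forall>\<^sub>F t in at_right (0::real). \<psi> p + t *\<^sub>R b \<in> V \<and> dist (\<theta> (\<psi> p + t *\<^sub>R b)) p < e"
    by (rule eventually_compose_filterlim)
  then have "\<exists>t>0. \<psi> p + t *\<^sub>R b \<in> V \<and> dist (\<theta> (\<psi> p + t *\<^sub>R b)) p < e"
    unfolding eventually_at_right_field by (metis dense)
  then obtain t where t: "0 < t" "\<psi> p + t *\<^sub>R b \<in> V" "dist (\<theta> (\<psi> p + t *\<^sub>R b)) p < e"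
    by blast
  define y where "y = \<psi> p + t *\<^sub>R b"
  have yB: "y \<in> B"
  proof -
    have "0 < b \<bullet> y" if "b \<noteq> 0"
      using that t(1) x(2) by (auto simp: y_def inner_add_right intro!: add_nonneg_pos)
    then show ?thesis
      using t(2) x(1) L by (auto simp: B_def y_def intro!: subspace_add subspace_scale)
  qed
  have qA: "\<theta> y \<in> A" "\<theta> y \<in> S"
    using B[OF yB] \<open>A \<subseteq> S\<close> by auto
  obtain U' V' \<psi>' \<theta>' L' where qU: "\<theta> y \<in> U'" and ch': "local_diffeo_chart r U' V' \<psi>' \<theta>'"
    and L': "subspace L'" "dim L' = d" and im': "\<psi>' ` (S \<inter> U') = L' \<inter> V'"
    using bspec[OF S[unfolded embedded_submanifold_def] qA(2)] by (elim exE conjE) (rule that)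
  have UV': "open U'" and hom': "homeomorphism U' V' \<psi>' \<theta>'"
    using ch' by (auto simp: local_diffeo_chart_def)
  have \<theta>\<psi>': "\<And>x. x \<in> U' \<Longrightarrow> \<theta>' (\<psi>' x) = x" and cont\<psi>': "continuous_on U' \<psi>'"
    using hom' by (auto simp: homeomorphism_def)
  \<comment> \<open>The transition map \<open>\<psi>' \<circ> \<theta>\<close> between the two charts compares \<open>L\<close> with \<open>L'\<close>.\<close>
  define B' where "B' = B \<inter> (V \<inter> \<theta> -` U')"
  have "openin (top_of_set L) B'"
  proof -
    have "open (V \<inter> \<theta> -` U')"
      using continuous_open_preimage[OF cont\<theta> UV(2) UV'(1)] .
    moreover have "open ({v. 0 < b \<bullet> v} \<union> {v. b = 0})"
      by (auto intro!: open_Un open_halfspace_gt)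
    ultimately have "open (({v. 0 < b \<bullet> v} \<union> {v. b = 0}) \<inter> V \<inter> (V \<inter> \<theta> -` U'))"
      using UV(2) by (simp only: open_Int)
    moreover have "B' = L \<inter> (({v. 0 < b \<bullet> v} \<union> {v. b = 0}) \<inter> V \<inter> (V \<inter> \<theta> -` U'))"
      by (auto simp: B'_def B_def)
    ultimately show ?thesis
      by (auto simp: openin_open)
  qed
  then have "openin (top_of_set L') ((\<psi>' \<circ> \<theta>) ` B')"
  proof (rule invariance_of_domain_subspaces)
    show "continuous_on B' (\<psi>' \<circ> \<theta>)"
      by (intro continuous_on_compose continuous_on_subset[OF cont\<theta>] continuous_on_subset[OF cont\<psi>'])
         (auto simp: B'_def B_def)
    show "\<psi>' \<circ> \<theta> \<in> B' \<rightarrow> L'"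
    proof
      fix x assume "x \<in> B'"
      then have "\<theta> x \<in> S \<inter> U'"
        using B \<open>A \<subseteq> S\<close> by (auto simp: B'_def)
      then show "(\<psi>' \<circ> \<theta>) x \<in> L'"
        using im' by auto
    qed
    show "inj_on (\<psi>' \<circ> \<theta>) B'"
    proof (rule inj_onI)
      fix x1 x2 assume a: "x1 \<in> B'" "x2 \<in> B'" "(\<psi>' \<circ> \<theta>) x1 = (\<psi>' \<circ> \<theta>) x2"
      then have U: "\<theta> x1 \<in> U'" "\<theta> x2 \<in> U'" and V: "x1 \<in> V" "x2 \<in> V"
        by (auto simp: B'_def)
      have "\<theta>' (\<psi>' (\<theta> x1)) = \<theta>' (\<psi>' (\<theta> x2))"
        using a(3) by simp
      then have "\<theta> x1 = \<theta> x2"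
        unfolding \<theta>\<psi>'[OF U(1)] \<theta>\<psi>'[OF U(2)] .
      then have "\<psi> (\<theta> x1) = \<psi> (\<theta> x2)"
        by simp
      then show "x1 = x2"
        unfolding \<psi>\<theta>[OF V(1)] \<psi>\<theta>[OF V(2)] .
    qed
  qed (use L L' in auto)
  then obtain Q where Q: "open Q" "(\<psi>' \<circ> \<theta>) ` B' = L' \<inter> Q"
    by (auto simp: openin_open)
  define T where "T = S \<inter> (U' \<inter> \<psi>' -` Q)"
  have "openin (top_of_set S) T"
    using continuous_open_preimage[OF cont\<psi>' UV'(1) Q(1)] by (auto simp: T_def openin_open)
  moreover have "\<theta> y \<in> T"
  proof -
    have "y \<in> B'"
      using yB qU by (auto simp: B'_def B_def)
    then show ?thesis
      using Q(2) qA(2) qU by (auto simp: T_def)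
  qed
  moreover have "T \<subseteq> A"
  proof
    fix s assume s: "s \<in> T"
    then have "\<psi>' s \<in> L' \<inter> Q"
      using im' by (auto simp: T_def)
    then obtain x where x: "x \<in> B'" "\<psi>' s = \<psi>' (\<theta> x)"
      unfolding Q(2)[symmetric] by auto
    then have "\<theta>' (\<psi>' s) = \<theta>' (\<psi>' (\<theta> x))" "s \<in> U'" "\<theta> x \<in> U'"
      using s by (auto simp: B'_def T_def)
    then have "s = \<theta> x"
      by (simp only: \<theta>\<psi>')
    then show "s \<in> A"
      using B x(1) by (auto simp: B'_def)
  qed
  ultimately have "\<theta> y \<in> top_of_set S interior_of A"
    by (auto simp: interior_of_def)
  then show thesis
    using that qA(1) t(3) by (simp add: y_def)
qed

section \<open>Invertibility and projections\<close>

text \<open>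
  The algebraic multiplicity of the eigenvalue \<open>0\<close> is at least its geometric multiplicity. In a basis
  that contains \<open>d\<close> left null vectors of \<open>E\<close>, the corresponding \<open>d\<close> rows of the characteristic matrix
  are divisible by \<open>y\<close>.
\<close>

lemma det_char_matrix_vanishing_order:
  fixes E :: "real^'n^'n"
  assumes "rank E + d \<le> CARD('n)"
  obtains g where "continuous_on UNIV g" "\<And>y. det (mat y - E) = y ^ d * g y"
proof -
  let ?R = "range (\<lambda>x. E *v x)"
  \<comment> \<open>The left null space of \<open>E\<close>, as the orthogonal complement of the range.\<close>
  define K where "K = {v \<in> UNIV. \<forall>x\<in>?R. orthogonal x v}"
  have "dim K + dim ?R = dim (UNIV :: (real^'n) set)"
    unfolding K_def
    by (intro dim_subspace_orthogonal_to_vectors subset_UNIV subspace_UNIV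
        linear_subspace_image[OF matrix_vector_mul_linear])
  then have "d \<le> dim K"
    using assms by (simp add: rank_dim_range)
  obtain Bk where Bk: "Bk \<subseteq> K" "independent Bk" "card Bk = dim K"
    using basis_exists[of K] by metis
  obtain Bn where Bn: "Bk \<subseteq> Bn" "independent Bn" "span Bn = UNIV"
    using maximal_independent_subset_extend[OF subset_UNIV Bk(2)] by (metis top.extremum_uniqueI)
  have cardBn: "card Bn = CARD('n)" "finite Bn"
    using Bn(2,3) basis_card_eq_dim[of Bn UNIV] by (auto intro: independent_imp_finite)
  obtain J where J: "J \<subseteq> Bk" "card J = d"
    using \<open>d \<le> dim K\<close> Bk(3) obtain_subset_with_card_n by metis
  obtain b :: "'n \<Rightarrow> real^'n" where b: "bij_betw b UNIV Bn"
    using finite_same_card_bij[of "UNIV :: 'n set" Bn] cardBn by auto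
  define Q :: "real^'n^'n" where "Q = (\<chi> i. b i)"
  have "rows Q = Bn"
    using b by (auto simp: rows_def row_def Q_def bij_betw_def vec_lambda_eta)
  then have detQ: "det Q \<noteq> 0"
    using matrix_left_invertible_span_rows[of Q] Bn(3) invertible_left_inverse invertible_det_nz by metis
  define c where "c y i = (if b i \<in> J then y else 1)" for y :: real and i
  define a where "a y i = (if b i \<in> J then b i else y *s b i - (\<chi> j. b i \<bullet> column j E))" for y i
  have "card {i. b i \<in> J} = d"
  proof -
    have "card (b ` {i. b i \<in> J}) = card {i. b i \<in> J}"
      using b by (intro card_image) (auto simp: bij_betw_def inj_on_def)
    moreover have "J \<subseteq> range b"
      using b J Bn(1) by (auto simp: bij_betw_def)
    then have "b ` {i. b i \<in> J} = J"
      by blast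
    ultimately show ?thesis
      using J by simp
  qed
  then have prod_c: "(\<Prod>i\<in>UNIV. c y i) = y ^ d" for y
    by (simp add: c_def prod.If_cases)
  have rows_QE: "Q ** (mat y - E) = (\<chi> i. c y i *s a y i)" for y
  proof -
    have "(Q ** (mat y - E)) $ i $ j = (c y i *s a y i) $ j" for i j
    proof -
      have "(Q ** (mat y - E)) $ i $ j = y * b i $ j - b i \<bullet> column j E"
        by (simp add: matrix_matrix_mult_def Q_def mat_def inner_vec_def column_def right_diff_distrib
            sum_subtractf if_distrib[of "\<lambda>x. _ * x"] mult.commute cong: if_cong)
      moreover have "b i \<bullet> column j E = 0" if "b i \<in> J"
      proof -
        have "b i \<in> K"
          using that J Bk by auto
        then have "orthogonal (E *v axis j 1) (b i)"
          unfolding K_def by blast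
        then show ?thesis
          by (simp add: matrix_vector_mult_basis orthogonal_def inner_commute)
      qed
      ultimately show ?thesis
        by (simp add: c_def a_def)
    qed
    then show ?thesis
      by (simp add: vec_eq_iff)
  qed
  show thesis
  proof (rule that[of "\<lambda>y. det (\<chi> i. a y i) / det Q"])
    show "continuous_on UNIV (\<lambda>y. det (\<chi> i. a y i) / det Q)"
    proof -
      have "continuous_on UNIV (\<lambda>y. a y i $ j)" for i j
        by (cases "b i \<in> J") (simp_all add: a_def, intro continuous_intros)
      then have "continuous_on UNIV (\<lambda>y. det (\<chi> i. a y i))"
        unfolding det_def
        by (simp, intro continuous_on_sum continuous_on_mult continuous_on_prod continuous_on_const)
      then show ?thesis
        using detQ by (intro continuous_on_divide continuous_on_const) auto
    qed
    fix y
    have "det Q * det (mat y - E) = y ^ d * det (\<chi> i. a y i)"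
      unfolding det_mul[symmetric] rows_QE det_rows_mul prod_c ..
    then show "det (mat y - E) = y ^ d * (det (\<chi> i. a y i) / det Q)"
      using detQ by (simp add: field_simps)
  qed
qed

lemma abs_det_uminus:
  fixes A :: "real^'n^'n"
  shows "\<bar>det (- A)\<bar> = \<bar>det A\<bar>"
proof -
  have "- A = (\<chi> i. (-1) *s A $ i)"
    by (simp add: vec_eq_iff)
  then have "det (- A) = (\<Prod>i\<in>(UNIV :: 'n set). -1) * det (\<chi> i. A $ i)"
    by (simp only: det_rows_mul)
  then show ?thesis
    by (simp add: vec_lambda_eta abs_mult power_abs)
qed

text \<open>
  If \<open>F N\<close> is singular, \<open>N F\<close> may still have only a \<open>k\<close>-dimensional kernel, with a Jordan block at
  \<open>0\<close>. Passing to the square \<open>(N F)\<^sup>2 = N (F N) F\<close>, whose rank is at most that of \<open>F N\<close>, turns the defect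
  into a geometric one. Its characteristic polynomial at \<open>t\<^sup>2\<close> is, up to sign, the product of those
  of \<open>N F\<close> at \<open>t\<close> and at \<open>-t\<close>, of order exactly \<open>2 k\<close> in \<open>t\<close>, whereas rank \<open>< m\<close> forces order at
  least \<open>2 (k + 1)\<close>. The hypothesis is stated for absolute values so that it can be read off from a
  factorisation over the complex numbers.
\<close>

lemma invertible_if_char_poly_order:
  fixes N :: "real^'m^'n" and F :: "real^'n^'m"
  assumes dims: "CARD('n) = k + CARD('m)"
    and det: "\<And>t. \<bar>det (mat t - N ** F)\<bar> = \<bar>t\<bar> ^ k * q t"
    and q: "isCont q 0" "q 0 \<noteq> 0"
  shows "invertible (F ** N)"
proof (rule ccontr)
  define B where "B = N ** F"
  assume "\<not> invertible (F ** N)"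
  then have "rank (F ** N) < CARD('m)"
    by (simp add: invertible_det_nz det_eq_0_rank)
  moreover have "B ** B = N ** ((F ** N) ** F)"
    by (simp add: B_def matrix_mul_assoc)
  ultimately have "rank (B ** B) < CARD('m)"
    using rank_mul_le_right[of N "(F ** N) ** F"] rank_mul_le_left[of "F ** N" F] by simp
  then have "rank (B ** B) + (k + 1) \<le> CARD('n)"
    using dims by simp
  then obtain g where g: "continuous_on UNIV g" "\<And>y. det (mat y - B ** B) = y ^ (k + 1) * g y"
    using det_char_matrix_vanishing_order by blast
  have eq: "q t * q (- t) = t\<^sup>2 * \<bar>g (t\<^sup>2)\<bar>" if "t \<noteq> 0" for t
  proof -
    have mat_vec: "mat s *v x = s *s x" for s :: real and x :: "real^'n"
      by (simp add: vec_eq_iff matrix_vector_mult_def mat_def if_distrib[of "\<lambda>x. x * _"] cong: if_cong)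
    have "mat (t\<^sup>2) - B ** B = (mat t - B) ** (mat t + B)"
      unfolding matrix_eq matrix_vector_mul_assoc[symmetric] matrix_vector_mult_diff_rdistrib
        matrix_vector_mult_add_rdistrib mat_vec
      by (simp add: matrix_vector_right_distrib vector_scalar_commute power2_eq_square vector_add_ldistrib
          vector_smult_assoc)
    moreover have "mat t + B = - (mat (- t) - B)"
      by (simp add: vec_eq_iff mat_def)
    ultimately have "\<bar>det (mat (t\<^sup>2) - B ** B)\<bar> = \<bar>det (mat t - B)\<bar> * \<bar>det (mat (- t) - B)\<bar>"
      by (simp only: det_mul abs_mult abs_det_uminus)
    then have "(\<bar>t\<bar> ^ k * \<bar>t\<bar> ^ k) * (q t * q (- t)) = \<bar>(t\<^sup>2) ^ (k + 1) * g (t\<^sup>2)\<bar>"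
      using det[of t] det[of "- t"] by (simp add: B_def[symmetric] g(2))
    also have "\<dots> = (\<bar>t\<bar> ^ k * \<bar>t\<bar> ^ k) * (t\<^sup>2 * \<bar>g (t\<^sup>2)\<bar>)"
      by (simp add: abs_mult power_abs power2_eq_square power_mult_distrib)
    finally show ?thesis
      using that by simp
  qed
  have "((\<lambda>t. q t * q (- t)) \<longlongrightarrow> q 0 * q 0) (at 0)"
  proof -
    have "isCont (\<lambda>t. q (- t)) 0"
      using q(1) by (intro isCont_o2[of 0 uminus q]) auto
    then show ?thesis
      using q(1) by (auto simp: isCont_def intro: tendsto_mult)
  qed
  moreover have "((\<lambda>t. q t * q (- t)) \<longlongrightarrow> 0) (at 0)"
  proof -
    have "isCont (\<lambda>t. t\<^sup>2 * \<bar>g (t\<^sup>2)\<bar>) 0"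
      using g(1) by (intro continuous_intros isCont_o2[of 0 "\<lambda>t. t\<^sup>2" g])
        (auto simp: continuous_on_eq_continuous_at intro!: continuous_intros)
    then have "((\<lambda>t. t\<^sup>2 * \<bar>g (t\<^sup>2)\<bar>) \<longlongrightarrow> 0) (at 0)"
      by (simp add: isCont_def)
    then show ?thesis
      by (rule Lim_transform_eventually) (auto simp: eventually_at_filter eq)
  qed
  ultimately have "q 0 * q 0 = 0"
    by (rule tendsto_unique[OF at_neq_bot])
  then show False
    using q(2) by simp
qed

lemma projection_onto_along_unique:
  assumes P: "is_projection_onto_along T F P" and P': "is_projection_onto_along T F P'"
  shows "P = P'"
proof
  fix v
  note P = P[unfolded is_projection_onto_along_def] and P' = P'[unfolded is_projection_onto_along_def]
  have lin: "linear P" "linear P'"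
    using P P' by blast+
  have ran: "range P = range P'" and ker: "{v. P v = 0} = {v. P' v = 0}"
    using P P' by metis+
  have idem: "P (P w) = P w" "P' (P' w) = P' w" for w
    using P P' by (metis comp_apply)+
  have "P' (v - P' v) = 0"
    by (simp add: linear_diff[OF lin(2)] idem)
  then have "P (v - P' v) = 0"
    using ker by blast
  moreover obtain w where "P' v = P w"
    using ran by blast
  ultimately show "P v = P' v"
    by (simp add: linear_diff[OF lin(1)] idem)
qed

lemma span_columns_eq_range:
  fixes A :: "real^'m^'n"
  shows "span (columns A) = range ((*v) A)"
proof
  show "span (columns A) \<subseteq> range ((*v) A)"
    by (intro span_minimal linear_subspace_image[OF matrix_vector_mul_linear] subspace_UNIV)
       (auto simp: columns_image_basis)
  show "range ((*v) A) \<subseteq> span (columns A)"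
    using matrix_vector_mult_in_columnspace by blast
qed

lemma matrix_inv_mult_vector:
  fixes A :: "real^'m^'m"
  assumes "invertible A"
  shows "matrix_inv A *v (A *v x) = x" "A *v (matrix_inv A *v x) = x"
  proof -
  have "A ** matrix_inv A = mat 1 \<and> matrix_inv A ** A = mat 1"
    using assms unfolding invertible_def matrix_inv_def by (rule someI_ex)
  then show "matrix_inv A *v (A *v x) = x" "A *v (matrix_inv A *v x) = x"
    by (simp_all add: matrix_vector_mul_assoc)
qed

text \<open>
  With \<open>C = F N\<close> the matrix \<open>N C\<^bsup>-1\<^esup> F\<close> is the identity on the columns of \<open>N\<close> and zero on the
  kernel of \<open>F\<close>, so its complement is the projection in the opposite direction.
\<close>

lemma is_projection_onto_kernel_along_columns:
  fixes N :: "real^'m^'n" and F :: "real^'n^'m"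
  assumes inv: "invertible (F ** N)"
  shows "is_projection_onto_along {v. F *v v = 0} (span (columns N))
    ((*v) (mat 1 - N ** matrix_inv (F ** N) ** F))"
proof -
  let ?C = "matrix_inv (F ** N)" and ?P = "(*v) (mat 1 - N ** matrix_inv (F ** N) ** F)"
  have P: "?P v = v - N *v (?C *v (F *v v))" for v
    by (simp add: matrix_vector_mult_diff_rdistrib matrix_vector_mul_assoc matrix_mul_assoc)
  have FN: "F *v (N *v (?C *v u)) = u" "?C *v (F *v (N *v u)) = u" for u
    using matrix_inv_mult_vector[OF inv, of u] by (simp_all add: matrix_vector_mul_assoc[symmetric])
  have FP: "F *v ?P v = 0" for v
    by (simp add: P matrix_vector_mult_diff_distrib FN)
  have fix_ker: "?P v = v" if "F *v v = 0" for v
    by (simp add: P that)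
  show ?thesis
    unfolding is_projection_onto_along_def span_columns_eq_range
  proof (intro conjI)
    show "linear ?P"
      by (rule matrix_vector_mul_linear)
    show "?P \<circ> ?P = ?P"
      using fix_ker[OF FP] by (simp add: fun_eq_iff)
    show "range ?P = {v. F *v v = 0}"
      using FP fix_ker by (auto simp: image_iff) metis
    show "{v. ?P v = 0} = range ((*v) N)"
      by (auto simp: P FN)
  qed
qed

lemma det_of_real_matrix:
  fixes M :: "real^'n^'n"
  shows "det ((\<chi> i j. complex_of_real (M $ i $ j)) :: complex^'n^'n) = complex_of_real (det M)"
  by (simp add: det_def)

section \<open>First-order motion on a slow manifold\<close>

lemma nonpos_if_le_linear:
  fixes x K \<tau> :: real
  assumes "0 < \<tau>" "\<And>\<epsilon>. 0 < \<epsilon> \<Longrightarrow> \<epsilon> < \<tau> \<Longrightarrow> x \<le> K * \<epsilon>"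
  shows "x \<le> 0"
proof -
  have "((\<lambda>\<epsilon>. K * \<epsilon>) \<longlongrightarrow> K * 0) (at_right 0)"
    by (intro tendsto_intros)
  moreover have "\<forall>\<^sub>F \<epsilon> in at_right 0. x \<le> K * \<epsilon>"
    using assms unfolding eventually_at_right_field by blast
  ultimately have "x \<le> K * 0"
    by (intro tendsto_lowerbound[OF _ _ trivial_limit_at_right_real])
  then show ?thesis
    by simp
qed

lemma norm_add_diff_le:
  fixes a b c :: "'a::real_normed_vector"
  assumes "norm a \<le> A" "norm b \<le> B" "norm c \<le> C"
  shows "norm (a + b - c) \<le> A + B + C"
  using norm_triangle_ineq4[of "a + b" c] norm_triangle_ineq[of a b] assms by linarith

text \<open>
  A family of maps \<open>H\<close> that fixes \<open>A\<close> at \<open>\<epsilon> = 0\<close>, and a family \<open>\<Phi>\<close> of \<open>O(\<epsilon>)\<close>-displacements of \<open>A\<close>,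
  near the point \<open>z0\<close>. The values of interest are those with \<open>0 \<le> \<epsilon>\<close>, for \<open>\<Phi>\<close> moreover those with
  \<open>z \<in> A\<close>, and these sets are not open; \<open>\<eta>\<close> and \<open>h\<close> are \<open>C\<^sup>2\<close> extensions to full neighbourhoods of
  \<open>(z0, 0)\<close>, whose derivatives at \<open>(z, 0)\<close> make sense.
\<close>

locale slow_family =
  fixes H \<Phi> :: "'a::euclidean_space \<Rightarrow> real \<Rightarrow> 'a" and A :: "'a set" and \<epsilon>0 K :: real
    and \<eta> h :: "'a \<times> real \<Rightarrow> 'a" and U W :: "('a \<times> real) set" and z0 :: 'a
  assumes \<epsilon>0: "0 < \<epsilon>0"
    and \<eta>: "C_diff 2 \<eta> U" "open U" "(z0, 0) \<in> U"
      "\<And>z \<epsilon>. (z, \<epsilon>) \<in> U \<Longrightarrow> 0 \<le> \<epsilon> \<Longrightarrow> \<epsilon> < \<epsilon>0 \<Longrightarrow> \<eta> (z, \<epsilon>) = H z \<epsilon>"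
    and h: "C_diff 2 h W" "open W" "(z0, 0) \<in> W"
      "\<And>z \<epsilon>. z \<in> A \<Longrightarrow> (z, \<epsilon>) \<in> W \<Longrightarrow> 0 \<le> \<epsilon> \<Longrightarrow> \<epsilon> < \<epsilon>0 \<Longrightarrow> h (z, \<epsilon>) = \<Phi> z \<epsilon>"
    and H0: "\<And>z. z \<in> A \<Longrightarrow> H z 0 = z"
    and \<Phi>0: "\<And>z. z \<in> A \<Longrightarrow> \<Phi> z 0 = z"
    and K: "0 \<le> K" "\<And>z \<epsilon>. z \<in> A \<Longrightarrow> 0 \<le> \<epsilon> \<Longrightarrow> \<epsilon> < \<epsilon>0 \<Longrightarrow> norm (\<Phi> z \<epsilon> - z) \<le> K * \<epsilon>"
begin

text \<open>The coefficient of \<open>\<epsilon>\<close> in \<open>\<Phi> z \<epsilon>\<close>.\<close>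

definition shift :: "'a \<Rightarrow> 'a" where
  "shift z = frechet_derivative h (at (z, 0)) (0, 1)"

text \<open>
  The coefficient of \<open>\<epsilon>\<close> in \<open>H (\<Phi> z \<epsilon>) \<epsilon> - \<Phi> z \<epsilon>\<close>, by the chain rule along \<open>\<epsilon> \<mapsto> (\<Phi> z \<epsilon>, \<epsilon>)\<close>,
  whose velocity at \<open>\<epsilon> = 0\<close> is \<open>(shift z, 1)\<close>.
\<close>

definition drift :: "'a \<Rightarrow> 'a" where
  "drift z = frechet_derivative \<eta> (at (z, 0)) (shift z, 1) - shift z"

text \<open>
  Uniformity over a ball, rather than an expansion at each base point, is what allows base points to
  move with \<open>\<epsilon>\<close> later on; for the same reason the coefficients are needed with Lipschitz bounds.
\<close>

lemma expansions:
  obtains \<delta> C where "0 < \<delta>" "\<delta> \<le> \<epsilon>0" "0 \<le> C" "\<And>z. z \<in> ball z0 \<delta> \<Longrightarrow> (z, 0) \<in> U"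
    "\<And>z \<epsilon>. z \<in> A \<Longrightarrow> z \<in> ball z0 \<delta> \<Longrightarrow> 0 \<le> \<epsilon> \<Longrightarrow> \<epsilon> < \<delta> \<Longrightarrow>
       norm (\<Phi> z \<epsilon> - z - \<epsilon> *\<^sub>R shift z) \<le> C * \<epsilon>\<^sup>2"
    "\<And>z \<epsilon>. z \<in> A \<Longrightarrow> z \<in> ball z0 \<delta> \<Longrightarrow> 0 \<le> \<epsilon> \<Longrightarrow> \<epsilon> < \<delta> \<Longrightarrow>
       norm (H (\<Phi> z \<epsilon>) \<epsilon> - \<Phi> z \<epsilon> - \<epsilon> *\<^sub>R drift z) \<le> C * \<epsilon>\<^sup>2"
    "\<And>z w. z \<in> ball z0 \<delta> \<Longrightarrow> w \<in> ball z0 \<delta> \<Longrightarrow> norm (shift z - shift w) \<le> C * norm (z - w)"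
    "\<And>z w. z \<in> ball z0 \<delta> \<Longrightarrow> w \<in> ball z0 \<delta> \<Longrightarrow> norm (drift z - drift w) \<le> C * norm (z - w)"
proof -
  let ?Dh = "\<lambda>x. frechet_derivative h (at x)" and ?D\<eta> = "\<lambda>x. frechet_derivative \<eta> (at x)"
  obtain dh Ch where dh: "0 < dh" "0 \<le> Ch" "ball (z0, 0) dh \<subseteq> W"
    and h1: "\<And>x v. x \<in> ball (z0, 0) dh \<Longrightarrow> norm (?Dh x v) \<le> Ch * norm v"
    and h2: "\<And>x y v. x \<in> ball (z0, 0) dh \<Longrightarrow> y \<in> ball (z0, 0) dh \<Longrightarrow>
       norm (?Dh x v - ?Dh y v) \<le> Ch * norm (x - y) * norm v"
    and h3: "\<And>x y. x \<in> ball (z0, 0) dh \<Longrightarrow> y \<in> ball (z0, 0) dh \<Longrightarrow>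
       norm (h y - h x - ?Dh x (y - x)) \<le> Ch * (norm (y - x))\<^sup>2"
    using C_diff_2_local_bounds[OF h(1-3)] by metis
  obtain de Ce where de: "0 < de" "0 \<le> Ce" "ball (z0, 0) de \<subseteq> U"
    and e1: "\<And>x v. x \<in> ball (z0, 0) de \<Longrightarrow> norm (?D\<eta> x v) \<le> Ce * norm v"
    and e2: "\<And>x y v. x \<in> ball (z0, 0) de \<Longrightarrow> y \<in> ball (z0, 0) de \<Longrightarrow>
       norm (?D\<eta> x v - ?D\<eta> y v) \<le> Ce * norm (x - y) * norm v"
    and e3: "\<And>x y. x \<in> ball (z0, 0) de \<Longrightarrow> y \<in> ball (z0, 0) de \<Longrightarrow>
       norm (\<eta> y - \<eta> x - ?D\<eta> x (y - x)) \<le> Ce * (norm (y - x))\<^sup>2"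
    using C_diff_2_local_bounds[OF \<eta>(1-3)] by metis
  define d where "d = min dh de"
  \<comment> \<open>The factor \<open>K + 1\<close> leaves room for the displacement, so that \<open>(\<Phi> z \<epsilon>, \<epsilon>)\<close> stays in the ball of \<open>\<eta>\<close>.\<close>
  define \<delta> where "\<delta> = min \<epsilon>0 (d / (4 * (K + 1)))"
  define C where "C = Ch + Ce * (K + 1)\<^sup>2 + Ce * Ch + Ce * (Ch + 1)"
  have d: "0 < d" "d \<le> dh" "d \<le> de"
    using dh de by (auto simp: d_def)
  have \<delta>: "0 < \<delta>" "\<delta> \<le> \<epsilon>0" "\<delta> * (K + 1) \<le> d / 4"
  proof -
    show "0 < \<delta>" "\<delta> \<le> \<epsilon>0"
      using d K(1) \<epsilon>0 by (auto simp: \<delta>_def)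
    have "\<delta> \<le> d / (4 * (K + 1))"
      by (simp add: \<delta>_def)
    then show "\<delta> * (K + 1) \<le> d / 4"
      using K(1) by (simp add: field_simps)
  qed
  then have \<delta>4: "\<delta> \<le> d / 4"
    using mult_nonneg_nonneg[OF K(1) less_imp_le[OF \<delta>(1)]] by (simp add: algebra_simps)
  have in_ball: "(z, s) \<in> ball (z0, 0) dh" "(z, s) \<in> ball (z0, 0) de"
    if "norm (z - z0) \<le> d / 4" "0 \<le> s" "s < d / 4" for z and s :: real
  proof -
    have "norm ((z, s) - (z0, 0)) \<le> norm (z - z0) + norm s"
      using norm_Pair_le[of "z - z0" s] by simp
    also have "\<dots> < d"
      using that d(1) by simp
    finally have "dist (z, s) (z0, 0) < d"
      by (simp only: dist_norm)
    then show "(z, s) \<in> ball (z0, 0) dh" "(z, s) \<in> ball (z0, 0) de"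
      using d(2,3) by (simp_all add: dist_commute)
  qed
  have in_ball_\<delta>: "(z, s) \<in> ball (z0, 0) dh" "(z, s) \<in> ball (z0, 0) de"
    if "z \<in> ball z0 \<delta>" "0 \<le> s" "s < \<delta>" for z and s :: real
  proof -
    have "norm (z - z0) \<le> d / 4" "s < d / 4"
      using that \<delta>4 by (simp_all add: dist_norm norm_minus_commute)
    then show "(z, s) \<in> ball (z0, 0) dh" "(z, s) \<in> ball (z0, 0) de"
      using in_ball that(2) by blast+
  qed
  have base: "(z, 0 :: real) \<in> ball (z0, 0) dh" "(z, 0 :: real) \<in> ball (z0, 0) de" if "z \<in> ball z0 \<delta>" for z
    by (fact in_ball_\<delta>[OF that order_refl \<delta>(1)])+
  have Dh_lin: "linear (?Dh x)" if "x \<in> ball (z0, 0) dh" for x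
    using C_diff_has_derivative[OF h(1) _ subsetD[OF dh(3) that]] by (simp add: has_derivative_linear)
  have D\<eta>_lin: "linear (?D\<eta> x)" if "x \<in> ball (z0, 0) de" for x
    using C_diff_has_derivative[OF \<eta>(1) _ subsetD[OF de(3) that]] by (simp add: has_derivative_linear)
  have C_ge: "0 \<le> Ce * (K + 1)\<^sup>2" "0 \<le> Ce * Ch" "0 \<le> Ce * (Ch + 1)"
    using dh(2) de(2) by auto
  have shift_exp: "norm (\<Phi> z \<epsilon> - z - \<epsilon> *\<^sub>R shift z) \<le> Ch * \<epsilon>\<^sup>2"
    if z: "z \<in> A" "z \<in> ball z0 \<delta>" and \<epsilon>: "0 \<le> \<epsilon>" "\<epsilon> < \<delta>" for z \<epsilon>
  proof -
    have x: "(z, 0 :: real) \<in> ball (z0, 0) dh" "(z, \<epsilon>) \<in> ball (z0, 0) dh"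
      by (fact base(1)[OF z(2)] in_ball_\<delta>(1)[OF z(2) \<epsilon>])+
    have "\<epsilon> < \<epsilon>0"
      using \<epsilon> \<delta>(2) by simp
    have "h (z, \<epsilon>) = \<Phi> z \<epsilon>"
      using z(1) \<epsilon>(1) \<open>\<epsilon> < \<epsilon>0\<close> subsetD[OF dh(3) x(2)] by (intro h(4))
    moreover have "h (z, 0) = z"
      using h(4)[of z 0] z(1) \<epsilon>0 subsetD[OF dh(3) x(1)] \<Phi>0 by simp
    moreover have "?Dh (z, 0) ((z, \<epsilon>) - (z, 0)) = \<epsilon> *\<^sub>R shift z"
      unfolding shift_def linear_cmul[OF Dh_lin[OF x(1)], symmetric] by simp
    moreover have "norm ((z, \<epsilon>) - (z, 0)) = \<epsilon>"
      using \<epsilon>(1) by (simp add: norm_Pair)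
    ultimately show ?thesis
      using h3[OF x] by simp
  qed
  show thesis
  proof (rule that[of \<delta> C])
    show "0 < \<delta>" "\<delta> \<le> \<epsilon>0"
      by (fact \<delta>)+
    show "0 \<le> C"
      using C_ge dh(2) by (simp add: C_def)
    show "(z, 0) \<in> U" if "z \<in> ball z0 \<delta>" for z
      using base(2)[OF that] de(3) by blast
    show "norm (\<Phi> z \<epsilon> - z - \<epsilon> *\<^sub>R shift z) \<le> C * \<epsilon>\<^sup>2"
      if "z \<in> A" "z \<in> ball z0 \<delta>" "0 \<le> \<epsilon>" "\<epsilon> < \<delta>" for z \<epsilon>
    proof -
      have "Ch * \<epsilon>\<^sup>2 \<le> C * \<epsilon>\<^sup>2"
        using C_ge by (intro mult_right_mono) (auto simp: C_def)
      then show ?thesis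
        using shift_exp[OF that] by simp
    qed
    have shift_lip: "norm (shift z - shift w) \<le> Ch * norm (z - w)"
      if "z \<in> ball z0 \<delta>" "w \<in> ball z0 \<delta>" for z w
      using h2[OF base(1)[OF that(1)] base(1)[OF that(2)], of "(0, 1)"]
      by (simp add: shift_def norm_Pair)
    then show "norm (shift z - shift w) \<le> C * norm (z - w)"
      if "z \<in> ball z0 \<delta>" "w \<in> ball z0 \<delta>" for z w
    proof -
      have "Ch * norm (z - w) \<le> C * norm (z - w)"
        using C_ge by (intro mult_right_mono) (auto simp: C_def)
      then show ?thesis
        using shift_lip[OF that] by simp
    qed
    show "norm (drift z - drift w) \<le> C * norm (z - w)"
      if zw: "z \<in> ball z0 \<delta>" "w \<in> ball z0 \<delta>" for z w
    proof -
      note b = base(2)[OF zw(1)] base(2)[OF zw(2)]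
      let ?s = "norm (z - w)"
      have "norm (shift z) \<le> Ch"
        using h1[OF base(1)[OF zw(1)], of "(0, 1)"] by (simp add: shift_def norm_Pair)
      then have "norm (shift z, 1 :: real) \<le> Ch + 1"
        using norm_Pair_le[of "shift z" "1 :: real"] by simp
      then have "Ce * ?s * norm (shift z, 1 :: real) \<le> Ce * ?s * (Ch + 1)"
        using de(2) by (intro mult_left_mono) auto
      then have 1: "norm (?D\<eta> (z, 0) (shift z, 1) - ?D\<eta> (w, 0) (shift z, 1)) \<le> Ce * (Ch + 1) * ?s"
        using e2[OF b, of "(shift z, 1)"] by (simp add: norm_Pair mult.commute mult.left_commute)
      have "norm (?D\<eta> (w, 0) (shift z - shift w, 0)) \<le> Ce * norm (shift z - shift w)"
        using e1[OF b(2), of "(shift z - shift w, 0)"] by (simp add: norm_Pair)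
      also have "\<dots> \<le> Ce * (Ch * ?s)"
        using shift_lip[OF zw] de(2) by (intro mult_left_mono)
      finally have 2: "norm (?D\<eta> (w, 0) (shift z - shift w, 0)) \<le> Ce * Ch * ?s"
        by simp
      have "drift z - drift w = (?D\<eta> (z, 0) (shift z, 1) - ?D\<eta> (w, 0) (shift z, 1))
          + ?D\<eta> (w, 0) (shift z - shift w, 0) - (shift z - shift w)"
        using linear_diff[OF D\<eta>_lin[OF b(2)], of "(shift z, 1)" "(shift w, 1)"]
        by (simp add: drift_def algebra_simps)
      then have "norm (drift z - drift w) \<le> Ce * (Ch + 1) * ?s + Ce * Ch * ?s + Ch * ?s"
        using norm_add_diff_le[OF 1 2 shift_lip[OF zw]] by simp
      also have "\<dots> = (Ch + Ce * Ch + Ce * (Ch + 1)) * ?s"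
        by (simp add: algebra_simps)
      also have "\<dots> \<le> C * ?s"
        using C_ge by (intro mult_right_mono) (auto simp: C_def)
      finally show ?thesis .
    qed
    show "norm (H (\<Phi> z \<epsilon>) \<epsilon> - \<Phi> z \<epsilon> - \<epsilon> *\<^sub>R drift z) \<le> C * \<epsilon>\<^sup>2"
      if z: "z \<in> A" "z \<in> ball z0 \<delta>" and \<epsilon>: "0 \<le> \<epsilon>" "\<epsilon> < \<delta>" for z \<epsilon>
    proof -
      define e where "e = \<Phi> z \<epsilon> - z - \<epsilon> *\<^sub>R shift z"
      have \<epsilon>': "\<epsilon> < \<epsilon>0" "\<epsilon> < d / 4"
        using \<epsilon> \<delta>(2) \<delta>4 by auto
      have \<Phi>z: "norm (\<Phi> z \<epsilon> - z) \<le> K * \<epsilon>"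
        using K(2) z(1) \<epsilon>(1) \<epsilon>'(1) by blast
      have "K * \<epsilon> \<le> K * \<delta>"
        using K(1) \<epsilon> by (intro mult_left_mono) auto
      then have "norm (\<Phi> z \<epsilon> - z0) \<le> \<delta> * (K + 1)"
        using \<Phi>z z(2) norm_triangle_ineq[of "\<Phi> z \<epsilon> - z" "z - z0"]
        by (simp add: dist_norm norm_minus_commute algebra_simps)
      then have y: "(\<Phi> z \<epsilon>, \<epsilon>) \<in> ball (z0, 0) de"
        using \<delta>(3) \<epsilon>(1) \<epsilon>'(2) by (intro in_ball) auto
      note x = base(2)[OF z(2)]
      have "\<eta> (\<Phi> z \<epsilon>, \<epsilon>) = H (\<Phi> z \<epsilon>) \<epsilon>"
        using \<epsilon>(1) \<epsilon>'(1) subsetD[OF de(3) y] by (intro \<eta>(4))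
      moreover have "\<eta> (z, 0) = z"
        using \<eta>(4)[of z 0] z(1) \<epsilon>0 subsetD[OF de(3) x] H0 by simp
      moreover have "?D\<eta> (z, 0) ((\<Phi> z \<epsilon>, \<epsilon>) - (z, 0)) = \<epsilon> *\<^sub>R ?D\<eta> (z, 0) (shift z, 1) + ?D\<eta> (z, 0) (e, 0)"
        unfolding linear_cmul[OF D\<eta>_lin[OF x], symmetric] linear_add[OF D\<eta>_lin[OF x], symmetric]
        by (simp add: e_def)
      moreover have "norm ((\<Phi> z \<epsilon>, \<epsilon>) - (z, 0)) \<le> (K + 1) * \<epsilon>"
        using norm_Pair_le[of "\<Phi> z \<epsilon> - z" \<epsilon>] \<Phi>z \<epsilon>(1) by (simp add: algebra_simps)
      then have "Ce * (norm ((\<Phi> z \<epsilon>, \<epsilon>) - (z, 0)))\<^sup>2 \<le> Ce * ((K + 1) * \<epsilon>)\<^sup>2"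
        using de(2) by (intro mult_left_mono power_mono) auto
      ultimately have 1: "norm (H (\<Phi> z \<epsilon>) \<epsilon> - z - (\<epsilon> *\<^sub>R ?D\<eta> (z, 0) (shift z, 1) + ?D\<eta> (z, 0) (e, 0)))
          \<le> Ce * (K + 1)\<^sup>2 * \<epsilon>\<^sup>2"
        using e3[OF x y] by (simp add: power_mult_distrib)
      have e: "norm e \<le> Ch * \<epsilon>\<^sup>2"
        using shift_exp[OF z \<epsilon>] by (simp add: e_def)
      have "norm (?D\<eta> (z, 0) (e, 0)) \<le> Ce * norm e"
        using e1[OF x, of "(e, 0)"] by (simp add: norm_Pair)
      also have "\<dots> \<le> Ce * (Ch * \<epsilon>\<^sup>2)"
        using e de(2) by (intro mult_left_mono)
      finally have 2: "norm (?D\<eta> (z, 0) (e, 0)) \<le> Ce * Ch * \<epsilon>\<^sup>2"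
        by simp
      have "H (\<Phi> z \<epsilon>) \<epsilon> - \<Phi> z \<epsilon> - \<epsilon> *\<^sub>R drift z =
          (H (\<Phi> z \<epsilon>) \<epsilon> - z - (\<epsilon> *\<^sub>R ?D\<eta> (z, 0) (shift z, 1) + ?D\<eta> (z, 0) (e, 0))) + ?D\<eta> (z, 0) (e, 0) - e"
        by (simp add: drift_def e_def algebra_simps)
      then have "norm (H (\<Phi> z \<epsilon>) \<epsilon> - \<Phi> z \<epsilon> - \<epsilon> *\<^sub>R drift z) \<le>
          Ce * (K + 1)\<^sup>2 * \<epsilon>\<^sup>2 + Ce * Ch * \<epsilon>\<^sup>2 + Ch * \<epsilon>\<^sup>2"
        using norm_add_diff_le[OF 1 2 e] by (simp only:)
      also have "\<dots> = (Ch + Ce * (K + 1)\<^sup>2 + Ce * Ch) * \<epsilon>\<^sup>2"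
        by (simp add: algebra_simps)
      also have "\<dots> \<le> C * \<epsilon>\<^sup>2"
        using C_ge by (intro mult_right_mono) (auto simp: C_def)
      finally show ?thesis .
    qed
  qed
qed

end

text \<open>
  An orbit on the slow manifold moves its base point from \<open>z\<close> to some \<open>w\<close> with
  \<open>w = z + \<epsilon> v(z) + O(\<epsilon>\<^sup>2)\<close>: the displacements of \<open>z\<close> and \<open>w\<close> from their lifted points are
  \<open>\<epsilon> s(z)\<close> and \<open>\<epsilon> s(w)\<close>, which agree up to \<open>O(\<epsilon>\<^sup>2)\<close> because \<open>s\<close> is Lipschitz and \<open>w - z = O(\<epsilon>)\<close>.
  As \<open>f\<close> vanishes at both ends, \<open>\<epsilon> Df(z) v(z) = O(\<epsilon>\<^sup>2)\<close>.
\<close>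

lemma tangent_first_order_motion:
  fixes f :: "'a::euclidean_space \<Rightarrow> 'b::euclidean_space" and \<Phi> :: "'a \<Rightarrow> real \<Rightarrow> 'a"
    and H :: "'a \<Rightarrow> real \<Rightarrow> 'a" and s v :: "'a \<Rightarrow> 'a"
  assumes f: "C_diff 2 f V" "open V" "z \<in> V" and A: "\<And>w. w \<in> A \<Longrightarrow> f w = 0"
    and z: "z \<in> A" "z \<in> ball z0 \<delta>"
    and C: "0 \<le> C" and \<delta>: "0 < \<delta>" "\<delta> \<le> \<epsilon>0"
    and \<Phi>: "\<And>z \<epsilon>. z \<in> A \<Longrightarrow> z \<in> ball z0 \<delta> \<Longrightarrow> 0 \<le> \<epsilon> \<Longrightarrow> \<epsilon> < \<delta> \<Longrightarrow>
       norm (\<Phi> z \<epsilon> - z - \<epsilon> *\<^sub>R s z) \<le> C * \<epsilon>\<^sup>2"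
    and H: "\<And>\<epsilon>. 0 \<le> \<epsilon> \<Longrightarrow> \<epsilon> < \<delta> \<Longrightarrow> norm (H (\<Phi> z \<epsilon>) \<epsilon> - \<Phi> z \<epsilon> - \<epsilon> *\<^sub>R v z) \<le> C * \<epsilon>\<^sup>2"
    and s: "\<And>w. w \<in> ball z0 \<delta> \<Longrightarrow> norm (s w - s z) \<le> C * norm (w - z)"
    and K: "0 \<le> K" "\<And>z \<epsilon>. z \<in> A \<Longrightarrow> 0 \<le> \<epsilon> \<Longrightarrow> \<epsilon> < \<epsilon>0 \<Longrightarrow> norm (\<Phi> z \<epsilon> - z) \<le> K * \<epsilon>"
    and d: "0 < d"
    and inv: "\<And>\<epsilon>. 0 \<le> \<epsilon> \<Longrightarrow> \<epsilon> < \<epsilon>0 \<Longrightarrow> \<epsilon> < d \<Longrightarrow> dist (H (\<Phi> z \<epsilon>) \<epsilon>) z < d \<Longrightarrow>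
       H (\<Phi> z \<epsilon>) \<epsilon> \<in> (\<lambda>z. \<Phi> z \<epsilon>) ` A"
  shows "frechet_derivative f (at z) (v z) = 0"
proof -
  let ?D = "frechet_derivative f (at z)"
  obtain e Cf where e: "0 < e" "0 \<le> Cf" "ball z e \<subseteq> V"
    and f1: "\<And>x v. x \<in> ball z e \<Longrightarrow> norm (frechet_derivative f (at x) v) \<le> Cf * norm v"
    and f3: "\<And>x y. x \<in> ball z e \<Longrightarrow> y \<in> ball z e \<Longrightarrow>
       norm (f y - f x - frechet_derivative f (at x) (y - x)) \<le> Cf * (norm (y - x))\<^sup>2"
    using C_diff_2_local_bounds[OF f] by metis
  have lin: "linear ?D"
    using C_diff_has_derivative[OF f(1) _ f(3)] by (simp add: has_derivative_linear)
  have zz: "z \<in> ball z e"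
    using e(1) by simp
  \<comment> \<open>\<open>K1 \<epsilon>\<close> bounds the distance from \<open>z\<close> to the image point, \<open>K2 \<epsilon>\<close> the distance to its base point
    \<open>w\<close>, and \<open>K3 \<epsilon>\<^sup>2\<close> the remainder \<open>w - z - \<epsilon> v z\<close>.\<close>
  define K1 where "K1 = K + norm (v z) + C"
  define K2 where "K2 = K + K1"
  define K3 where "K3 = C + C + C + C * K2"
  define \<rho> where "\<rho> = min d (min (\<delta> - dist z0 z) e)"
  define \<tau> where "\<tau> = min (min 1 \<delta>) (min d (\<rho> / (K2 + 1)))"
  have K1: "0 \<le> K1" and K2: "0 \<le> K2"
    using K(1) C by (auto simp: K1_def K2_def)
  have \<rho>: "0 < \<rho>" "\<rho> \<le> d" "\<rho> \<le> \<delta> - dist z0 z" "\<rho> \<le> e"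
    using d e(1) z(2) by (auto simp: \<rho>_def)
  have \<tau>: "0 < \<tau>" "\<tau> \<le> 1" "\<tau> \<le> \<delta>" "\<tau> \<le> d" "\<tau> \<le> \<rho> / (K2 + 1)"
    using \<delta> d \<rho>(1) K2 by (auto simp: \<tau>_def)
  have "norm (?D (v z)) \<le> (Cf * K3 + Cf * K2\<^sup>2) * \<epsilon>" if \<epsilon>: "0 < \<epsilon>" "\<epsilon> < \<tau>" for \<epsilon>
  proof -
    let ?y = "H (\<Phi> z \<epsilon>) \<epsilon>"
    have \<epsilon>': "0 \<le> \<epsilon>" "\<epsilon> < \<delta>" "\<epsilon> < \<epsilon>0" "\<epsilon> < d" "\<epsilon> \<le> 1"
      using \<epsilon> \<tau> \<delta>(2) by auto
    have "\<epsilon> < \<rho> / (K2 + 1)"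
      using \<epsilon>(2) \<tau>(5) by linarith
    then have "(K2 + 1) * \<epsilon> < \<rho>"
      using K2 by (simp add: pos_less_divide_eq mult.commute)
    then have K2\<epsilon>: "K2 * \<epsilon> < \<rho>"
      using \<epsilon>(1) by (simp add: algebra_simps)
    have "C * \<epsilon>\<^sup>2 \<le> C * \<epsilon>"
      using C \<epsilon>' by (intro mult_left_mono) (auto simp: power2_eq_square mult_left_le)
    moreover have "norm (?y - z) \<le> norm (?y - \<Phi> z \<epsilon> - \<epsilon> *\<^sub>R v z) + norm (\<epsilon> *\<^sub>R v z) + norm (\<Phi> z \<epsilon> - z)"
      using norm_triangle_ineq[of "?y - \<Phi> z \<epsilon> - \<epsilon> *\<^sub>R v z" "\<epsilon> *\<^sub>R v z"]
        norm_triangle_ineq[of "?y - \<Phi> z \<epsilon>" "\<Phi> z \<epsilon> - z"] by simp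
    moreover have "norm (\<epsilon> *\<^sub>R v z) = norm (v z) * \<epsilon>"
      using \<epsilon>'(1) by simp
    ultimately have "norm (?y - z) \<le> C * \<epsilon> + norm (v z) * \<epsilon> + K * \<epsilon>"
      using H[OF \<epsilon>'(1,2)] K(2)[OF z(1) \<epsilon>'(1,3)] by linarith
    then have yz: "norm (?y - z) \<le> K1 * \<epsilon>"
      by (simp add: K1_def algebra_simps)
    also have "K1 * \<epsilon> \<le> K2 * \<epsilon>"
      using K(1) \<epsilon>'(1) by (intro mult_right_mono) (auto simp: K2_def)
    finally have "dist ?y z < d"
      using K2\<epsilon> \<rho>(2) by (simp add: dist_norm)
    then obtain w where w: "w \<in> A" "?y = \<Phi> w \<epsilon>"
      using inv[OF \<epsilon>'(1,3,4)] by blast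
    have "norm (w - z) \<le> norm (\<Phi> w \<epsilon> - w) + norm (?y - z)"
      unfolding w(2) using norm_triangle_ineq4[of "\<Phi> w \<epsilon> - z" "\<Phi> w \<epsilon> - w"] by simp
    then have wz: "norm (w - z) \<le> K2 * \<epsilon>"
      using yz K(2)[OF w(1) \<epsilon>'(1,3)] by (simp add: K2_def algebra_simps)
    have "dist z w < \<rho>"
      using wz K2\<epsilon> by (simp add: dist_norm norm_minus_commute)
    then have wb: "w \<in> ball z0 \<delta>" "w \<in> ball z e"
      using \<rho>(3,4) dist_triangle[of z0 w z] by auto
    define r where "r = (?y - \<Phi> z \<epsilon> - \<epsilon> *\<^sub>R v z) + (\<Phi> z \<epsilon> - z - \<epsilon> *\<^sub>R s z)
        - ((\<Phi> w \<epsilon> - w - \<epsilon> *\<^sub>R s w) + \<epsilon> *\<^sub>R (s w - s z))"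
    have r: "w - z = \<epsilon> *\<^sub>R v z + r"
      by (simp add: r_def w(2) algebra_simps)
    have "norm (s w - s z) \<le> C * (K2 * \<epsilon>)"
      using s[OF wb(1)] mult_left_mono[OF wz C] by linarith
    then have "\<epsilon> * norm (s w - s z) \<le> \<epsilon> * (C * (K2 * \<epsilon>))"
      using \<epsilon>'(1) by (rule mult_left_mono)
    then have "norm (\<epsilon> *\<^sub>R (s w - s z)) \<le> C * K2 * \<epsilon>\<^sup>2"
      using \<epsilon>'(1) by (simp add: power2_eq_square ac_simps)
    then have "norm ((\<Phi> w \<epsilon> - w - \<epsilon> *\<^sub>R s w) + \<epsilon> *\<^sub>R (s w - s z)) \<le> C * \<epsilon>\<^sup>2 + C * K2 * \<epsilon>\<^sup>2"
      by (rule norm_triangle_mono[OF \<Phi>[OF w(1) wb(1) \<epsilon>'(1,2)]])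
    then have "norm r \<le> C * \<epsilon>\<^sup>2 + C * \<epsilon>\<^sup>2 + (C * \<epsilon>\<^sup>2 + C * K2 * \<epsilon>\<^sup>2)"
      unfolding r_def by (rule norm_add_diff_le[OF H[OF \<epsilon>'(1,2)] \<Phi>[OF z \<epsilon>'(1,2)]])
    also have "\<dots> = K3 * \<epsilon>\<^sup>2"
      by (simp add: K3_def algebra_simps)
    finally have "Cf * norm r \<le> Cf * (K3 * \<epsilon>\<^sup>2)"
      using e(2) by (intro mult_left_mono)
    then have Dr: "norm (?D r) \<le> Cf * K3 * \<epsilon>\<^sup>2"
      using f1[OF zz, of r] by simp
    have "norm (?D (w - z)) \<le> Cf * (norm (w - z))\<^sup>2"
      using f3[OF zz wb(2)] A[OF w(1)] A[OF z(1)] by simp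
    also have "\<dots> \<le> Cf * (K2 * \<epsilon>)\<^sup>2"
      using wz e(2) by (intro mult_left_mono power_mono) auto
    finally have Dwz: "norm (?D (w - z)) \<le> Cf * K2\<^sup>2 * \<epsilon>\<^sup>2"
      by (simp add: power_mult_distrib)
    have "\<epsilon> *\<^sub>R ?D (v z) = ?D (w - z) - ?D r"
      unfolding r linear_add[OF lin] linear_cmul[OF lin] by simp
    then have "norm (\<epsilon> *\<^sub>R ?D (v z)) \<le> norm (?D (w - z)) + norm (?D r)"
      by (simp only: norm_triangle_ineq4)
    then have "\<epsilon> * norm (?D (v z)) \<le> \<epsilon> * ((Cf * K3 + Cf * K2\<^sup>2) * \<epsilon>)"
      using Dr Dwz \<epsilon>'(1) by (simp add: power2_eq_square algebra_simps)
    then show ?thesis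
      using \<epsilon>(1) by simp
  qed
  then have "norm (?D (v z)) \<le> 0"
    by (rule nonpos_if_le_linear[OF \<tau>(1)])
  then show ?thesis
    by simp
qed

text \<open>
  Points of the boundary of \<open>S\<^sub>n\<close> are not covered by local invariance; they are reached by continuity
  of \<open>z \<mapsto> Df(z) v(z)\<close>.
\<close>

lemma kernel_condition_at_limit_point:
  fixes f :: "'a::euclidean_space \<Rightarrow> 'b::euclidean_space" and v :: "'a \<Rightarrow> 'a"
  assumes f: "C_diff 2 f V" "open V" "z \<in> V" and z: "z \<in> ball z0 \<delta>"
    and v: "0 \<le> C" "\<And>w. w \<in> ball z0 \<delta> \<Longrightarrow> norm (v z - v w) \<le> C * norm (z - w)"
    and ker: "\<And>w. w \<in> B \<Longrightarrow> w \<in> ball z0 \<delta> \<Longrightarrow> frechet_derivative f (at w) (v w) = 0"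
    and dense: "\<And>e. 0 < e \<Longrightarrow> \<exists>w\<in>B. dist w z < e"
  shows "frechet_derivative f (at z) (v z) = 0"
proof -
  let ?D = "\<lambda>x. frechet_derivative f (at x)"
  obtain e Cf where e: "0 < e" "0 \<le> Cf" "ball z e \<subseteq> V"
    and f1: "\<And>x v. x \<in> ball z e \<Longrightarrow> norm (?D x v) \<le> Cf * norm v"
    and f2: "\<And>x y v. x \<in> ball z e \<Longrightarrow> y \<in> ball z e \<Longrightarrow>
       norm (?D x v - ?D y v) \<le> Cf * norm (x - y) * norm v"
    using C_diff_2_local_bounds[OF f] by metis
  define \<tau> where "\<tau> = min e (\<delta> - dist z0 z)"
  have \<tau>: "0 < \<tau>" "\<tau> \<le> e" "\<tau> \<le> \<delta> - dist z0 z"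
    using e(1) z by (auto simp: \<tau>_def)
  have "norm (?D z (v z)) \<le> (Cf * norm (v z) + Cf * C) * \<epsilon>" if \<epsilon>: "0 < \<epsilon>" "\<epsilon> < \<tau>" for \<epsilon>
  proof -
    obtain w where w: "w \<in> B" "dist w z < \<epsilon>"
      using dense[OF \<epsilon>(1)] by blast
    have zw: "norm (z - w) \<le> \<epsilon>"
      using w(2) by (simp add: dist_norm norm_minus_commute)
    have wb: "w \<in> ball z e" "w \<in> ball z0 \<delta>" "z \<in> ball z e"
      using w(2) \<epsilon>(2) \<tau>(2,3) e(1) dist_triangle[of z0 w z] by (auto simp: dist_commute)
    have lin: "linear (?D w)"
      using C_diff_has_derivative[OF f(1) _ subsetD[OF e(3) wb(1)]] by (simp add: has_derivative_linear)
    have "norm (?D z (v z) - ?D w (v z)) \<le> Cf * norm (z - w) * norm (v z)"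
      using f2[OF wb(3,1)] .
    also have "\<dots> \<le> Cf * \<epsilon> * norm (v z)"
      using zw e(2) by (intro mult_right_mono mult_left_mono) auto
    finally have 1: "norm (?D z (v z) - ?D w (v z)) \<le> Cf * \<epsilon> * norm (v z)" .
    have "norm (?D w (v z - v w)) \<le> Cf * norm (v z - v w)"
      using f1[OF wb(1)] .
    also have "\<dots> \<le> Cf * (C * \<epsilon>)"
      using v(2)[OF wb(2)] mult_left_mono[OF zw v(1)] e(2) by (intro mult_left_mono) auto
    finally have 2: "norm (?D w (v z - v w)) \<le> Cf * (C * \<epsilon>)" .
    have "?D z (v z) = (?D z (v z) - ?D w (v z)) + ?D w (v z - v w)"
      using ker[OF w(1) wb(2)] by (simp add: linear_diff[OF lin])
    then have "norm (?D z (v z)) \<le> norm (?D z (v z) - ?D w (v z)) + norm (?D w (v z - v w))"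
      using norm_triangle_ineq by metis
    then show ?thesis
      using 1 2 by (simp add: algebra_simps)
  qed
  then have "norm (?D z (v z)) \<le> 0"
    by (rule nonpos_if_le_linear[OF \<tau>(1)])
  then show ?thesis
    by simp
qed

section \<open>Uniform constants on compact sets\<close>

text \<open>
  A Lebesgue number argument: local constants become global ones for pairs of points that are close
  to each other.
\<close>

lemma compact_uniform_constants:
  fixes Q :: "real \<Rightarrow> real \<Rightarrow> 'a::metric_space \<Rightarrow> 'a \<Rightarrow> bool"
  assumes "compact A"
    and mono: "\<And>C C' \<epsilon> y z. Q C \<epsilon> y z \<Longrightarrow> C \<le> C' \<Longrightarrow> Q C' \<epsilon> y z"
    and local: "\<And>x. x \<in> A \<Longrightarrow> \<exists>\<delta> C. 0 < \<delta> \<and>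
      (\<forall>y\<in>A \<inter> ball x \<delta>. \<forall>z\<in>A \<inter> ball x \<delta>. \<forall>\<epsilon>\<in>{0..<\<delta>}. Q C \<epsilon> y z)"
  obtains \<delta> C where "0 < \<delta>" "\<And>y z \<epsilon>. y \<in> A \<Longrightarrow> z \<in> A \<Longrightarrow> dist y z < \<delta> \<Longrightarrow> \<epsilon> \<in> {0..<\<delta>} \<Longrightarrow> Q C \<epsilon> y z"
proof -
  obtain d c where d: "\<And>x. x \<in> A \<Longrightarrow> 0 < d x"
    and c: "\<And>x y z \<epsilon>. x \<in> A \<Longrightarrow> y \<in> A \<inter> ball x (d x) \<Longrightarrow> z \<in> A \<inter> ball x (d x) \<Longrightarrow> \<epsilon> \<in> {0..<d x} \<Longrightarrow>
      Q (c x) \<epsilon> y z"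
    using local by metis
  have "A \<subseteq> (\<Union>x\<in>A. ball x (d x / 2))"
    using d by force
  then obtain T where T: "T \<subseteq> A" "finite T" "A \<subseteq> (\<Union>x\<in>T. ball x (d x / 2))"
    using compactE_image[OF \<open>compact A\<close>, of A "\<lambda>x. ball x (d x / 2)"] by auto
  define \<delta> where "\<delta> = Min (insert 1 ((\<lambda>x. d x / 2) ` T))"
  define C where "C = Max (insert 0 (c ` T))"
  have \<delta>: "0 < \<delta>"
    using T(1,2) d by (auto simp: \<delta>_def)
  have \<delta>_le: "\<delta> \<le> d x / 2" if "x \<in> T" for x
    unfolding \<delta>_def using T(2) that by (intro Min_le) auto
  have C: "c x \<le> C" if "x \<in> T" for x
    unfolding C_def using T(2) that by (intro Max_ge) auto
  show thesis
  proof (rule that[OF \<delta>])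
    fix y z \<epsilon> assume yz: "y \<in> A" "z \<in> A" "dist y z < \<delta>" and \<epsilon>: "\<epsilon> \<in> {0..<\<delta>}"
    obtain x where x: "x \<in> T" "dist x y < d x / 2"
      using T(3) yz(1) by auto
    then have "dist x z < d x" "0 < d x"
      using \<delta>_le[OF x(1)] yz(3) dist_triangle[of x z y] d T(1) by auto
    then have "Q (c x) \<epsilon> y z"
      using x \<delta>_le[OF x(1)] yz \<epsilon> T(1) by (intro c) auto
    then show "Q C \<epsilon> y z"
      using mono C[OF x(1)] by blast
  qed
qed

section \<open>Fast-slow maps\<close>

lemma bounded_bilinear_matrix_vector_mult:
  "bounded_bilinear (\<lambda>(A :: real^'m^'n) x. A *v x)"
  unfolding bilinear_conv_bounded_bilinear[symmetric] bilinear_def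
  by (auto intro!: linearI simp: matrix_vector_mult_add_rdistrib matrix_vector_right_distrib
      scaleR_matrix_vector_assoc matrix_vector_mult_scaleR)

text \<open>At a zero of \<open>f\<close> the term of the product rule that differentiates \<open>N\<close> drops out.\<close>

lemma has_derivative_fs_map_at_zero:
  fixes N :: "real^'n \<Rightarrow> real^'m^'n"
  assumes "N differentiable (at z)" "f differentiable (at z)" "f z = 0"
  shows "((\<lambda>w. fs_map N f G w 0) has_derivative (\<lambda>u. u + N z *v (jacobian f (at z) *v u))) (at z)"
proof -
  have "((\<lambda>w. N w *v f w) has_derivative
      (\<lambda>u. N z *v (jacobian f (at z) *v u) + frechet_derivative N (at z) u *v f z)) (at z)"
    using assms(1,2) unfolding jacobian_works
    by (intro bounded_bilinear.FDERIV[OF bounded_bilinear_matrix_vector_mult])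
       (simp_all add: frechet_derivative_works)
  then show ?thesis
    unfolding fs_map_def by (auto intro!: derivative_eq_intros simp: assms(3))
qed

text \<open>
  \<open>G\<close> is merely continuous, so \<open>\<epsilon> G(z, \<epsilon>)\<close> cannot be differentiated by the product rule. At \<open>\<epsilon> = 0\<close>
  continuity is enough.
\<close>

lemma has_vector_derivative_scaleR_continuous:
  fixes g :: "real \<Rightarrow> 'a::real_normed_vector"
  assumes "continuous (at 0 within T) g"
  shows "((\<lambda>s. c + s *\<^sub>R g s) has_vector_derivative g 0) (at 0 within T)"
  unfolding has_vector_derivative_def has_derivative_iff_norm
proof (intro conjI)
  show "bounded_linear (\<lambda>x. x *\<^sub>R g 0)"
    by (rule bounded_linear_scaleR_left)
  have "((\<lambda>s. norm (g s - g 0)) \<longlongrightarrow> 0) (at 0 within T)"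
    using assms by (simp add: continuous_within tendsto_norm_zero_iff LIM_zero_iff)
  moreover have "\<forall>\<^sub>F s in at 0 within T. norm (g s - g 0) =
      norm (c + s *\<^sub>R g s - (c + 0 *\<^sub>R g 0) - (s - 0) *\<^sub>R g 0) / norm (s - 0)"
    unfolding eventually_at_filter
    by (rule always_eventually) (simp add: scaleR_diff_right[symmetric])
  ultimately show "((\<lambda>s. norm (c + s *\<^sub>R g s - (c + 0 *\<^sub>R g 0) - (s - 0) *\<^sub>R g 0) / norm (s - 0)) \<longlongrightarrow> 0)
      (at 0 within T)"
    by (rule Lim_transform_eventually)
qed

lemma linear_inv_of_bij:
  assumes "linear L" "bij L"
  shows "linear (inv L)"
proof (rule linearI)
  have L_inv: "L (inv L y) = y" and inv_L: "inv L (L x) = x" for x y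
    using assms(2) by (simp_all add: bij_is_surj surj_f_inv_f bij_is_inj)
  show "inv L (x + y) = inv L x + inv L y" for x y
    using inv_L[of "inv L x + inv L y"] by (simp add: linear_add[OF assms(1)] L_inv)
  show "inv L (c *\<^sub>R x) = c *\<^sub>R inv L x" for c x
    using inv_L[of "c *\<^sub>R inv L x"] by (simp add: linear_cmul[OF assms(1)] L_inv)
qed

locale fast_slow_system =
  fixes N :: "real^'n \<Rightarrow> real^'m^'n" and f :: "real^'n \<Rightarrow> real^'m"
    and G :: "real^'n \<Rightarrow> real \<Rightarrow> real^'n" and S Sn :: "(real^'n) set"
    and M :: "real \<Rightarrow> (real^'n) set" and \<Phi> :: "real^'n \<Rightarrow> real \<Rightarrow> real^'n"
    and \<epsilon>0 :: real and r k :: nat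
  assumes dims: "CARD('n) = k + CARD('m)"
    and r: "2 \<le> r" and \<epsilon>0: "0 < \<epsilon>0"
    and smooth: "fs_smooth r \<epsilon>0 N f G"
    and A1: "assumption_fast_slow r k N f S"
    and A2: "assumption_factorisation N f S"
    and Sn: "Sn \<subseteq> S" "compact Sn" "connected Sn" "embedded_submanifold_bd r k Sn"
    and nh: "normally_hyperbolic k (fs_map N f G) S Sn"
    and slow: "slow_manifold r (fs_map N f G) S Sn \<epsilon>0 \<Phi> M"
begin

abbreviation H :: "real^'n \<Rightarrow> real \<Rightarrow> real^'n" where "H \<equiv> fs_map N f G"
abbreviation Df :: "real^'n \<Rightarrow> real^'n^'m" where "Df z \<equiv> jacobian f (at z)"
abbreviation proj :: "real^'n \<Rightarrow> real^'n \<Rightarrow> real^'n" where "proj z \<equiv> slow_projection N S z"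

lemma f_zero: "z \<in> Sn \<Longrightarrow> f z = 0"
  using A2 Sn(1) by (auto simp: assumption_factorisation_def)

lemma H_fixed: "z \<in> Sn \<Longrightarrow> H z 0 = z"
  by (simp add: fs_map_def f_zero)

lemma C2: "C_diff 2 N UNIV" "C_diff 2 f UNIV"
  using smooth r C_diff_le unfolding fs_smooth_def by blast+

lemma differentiable: "N differentiable (at z)" "f differentiable (at z)"
  using C_diff_has_derivative[OF C2(1), of z] C_diff_has_derivative[OF C2(2), of z]
  by (auto simp: differentiable_def)

lemma Df_mult: "Df z *v u = frechet_derivative f (at z) u"
  unfolding jacobian_def using differentiable(2)
  by (simp add: linear_frechet_derivative matrix_works)

lemma H_derivative:
  assumes "z \<in> Sn"
  shows "((\<lambda>w. H w 0) has_derivative (\<lambda>u. u + N z *v (Df z *v u))) (at z)"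
  using has_derivative_fs_map_at_zero[OF differentiable f_zero[OF assms]] .

lemma H_jacobian:
  assumes "z \<in> Sn"
  shows "jacobian (\<lambda>w. H w 0) (at z) = mat 1 + N z ** Df z"
proof -
  have "frechet_derivative (\<lambda>w. H w 0) (at z) = (\<lambda>u. u + N z *v (Df z *v u))"
    using frechet_derivative_at[OF H_derivative[OF assms]] by simp
  also have "\<dots> = (*v) (mat 1 + N z ** Df z)"
    by (simp add: fun_eq_iff matrix_vector_mult_add_rdistrib matrix_vector_mul_assoc)
  finally show ?thesis
    by (simp add: jacobian_def)
qed

text \<open>
  Normal hyperbolicity gives \<open>T\<^sub>z S\<close> as the eigenspace of \<open>I + N Df\<close> for the eigenvalue \<open>1\<close>, that is,
  \<open>ker (N Df)\<close>; full column rank of \<open>N\<close> reduces this to \<open>ker Df\<close>.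
\<close>

lemma tangent_space_eq_kernel:
  assumes "z \<in> Sn"
  shows "tangent_space S z = {v. Df z *v v = 0}"
proof -
  have "inj ((*v) (N z))"
    using A2 Sn(1) assms by (auto simp: assumption_factorisation_def full_rank_injective)
  then have "N z *v u = 0 \<longleftrightarrow> u = 0" for u
    using inj_eq[of "(*v) (N z)" u 0] by simp
  moreover have "{v. (mat 1 + N z ** Df z) *v v = v} = tangent_space S z"
    using nh assms by (simp add: normally_hyperbolic_def H_jacobian Let_def)
  ultimately show ?thesis
    by (auto simp: matrix_vector_mult_add_rdistrib matrix_vector_mul_assoc[symmetric])
qed

text \<open>
  Substituting \<open>x = t + 1\<close> in the characteristic polynomial of \<open>I + N Df\<close> gives
  \<open>t\<^sup>k \<Prod>(t + 1 - \<mu>\<^sub>j)\<close> for \<open>N Df\<close>. The cofactor of \<open>t\<^sup>k\<close> does not vanish at \<open>0\<close>, as \<open>\<bar>\<mu>\<^sub>j\<bar> \<noteq> 1\<close>.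
\<close>

lemma invertible_Df_N:
  assumes z: "z \<in> Sn"
  shows "invertible (Df z ** N z)"
proof -
  let ?A = "mat 1 + N z ** Df z" and ?m = "CARD('n) - k"
  obtain \<mu> :: "nat \<Rightarrow> complex" where \<mu>: "\<And>j. j < ?m \<Longrightarrow> cmod (\<mu> j) \<noteq> 1"
    and det: "\<And>x. det (mat x - (\<chi> i j. complex_of_real (?A $ i $ j)) :: complex^'n^'n)
                = (x - 1) ^ k * (\<Prod>j < ?m. x - \<mu> j)"
    using bspec[OF nh[unfolded normally_hyperbolic_def] z] unfolding Let_def H_jacobian[OF z] by blast
  define q where "q t = (\<Prod>j < ?m. cmod (complex_of_real (t + 1) - \<mu> j))" for t
  show ?thesis
  proof (rule invertible_if_char_poly_order[OF dims])
    fix t :: real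
    have mat_eq: "(mat (complex_of_real (t + 1)) - (\<chi> i j. complex_of_real (?A $ i $ j)) :: complex^'n^'n)
        = (\<chi> i j. complex_of_real ((mat t - N z ** Df z) $ i $ j))"
      by (simp add: vec_eq_iff mat_def)
    have "complex_of_real (det (mat t - N z ** Df z))
        = complex_of_real t ^ k * (\<Prod>j < ?m. complex_of_real (t + 1) - \<mu> j)"
      using det[of "complex_of_real (t + 1)"] unfolding mat_eq det_of_real_matrix by simp
    then have "cmod (complex_of_real (det (mat t - N z ** Df z))) = \<bar>t\<bar> ^ k * q t"
      by (simp add: norm_mult norm_power prod_norm q_def)
    then show "\<bar>det (mat t - N z ** Df z)\<bar> = \<bar>t\<bar> ^ k * q t"
      by simp
    show "isCont q 0"
      unfolding q_def by (intro continuous_intros)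
    have "\<mu> j \<noteq> 1" if "j < ?m" for j
      using \<mu>[OF that] by auto
    then show "q 0 \<noteq> 0"
      by (auto simp: q_def)
  qed
qed

lemma is_projection:
  assumes "z \<in> Sn"
  shows "is_projection_onto_along (tangent_space S z) (fast_fibre N z)
    ((*v) (mat 1 - N z ** matrix_inv (Df z ** N z) ** Df z))"
  using is_projection_onto_kernel_along_columns[OF invertible_Df_N[OF assms]]
  by (simp add: tangent_space_eq_kernel[OF assms])

lemma unique_projection:
  assumes "z \<in> Sn"
  shows "\<exists>!P. is_projection_onto_along (tangent_space S z) (fast_fibre N z) P"
  using is_projection[OF assms] projection_onto_along_unique by blast

lemma slow_projection_eq:
  assumes "z \<in> Sn"
  shows "proj z = (*v) (mat 1 - N z ** matrix_inv (Df z ** N z) ** Df z)"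
  unfolding slow_projection_def
  using is_projection[OF assms] projection_onto_along_unique by (intro the_equality) blast+

lemma slow_projection_eqI:
  assumes "z \<in> Sn" "Df z *v v = 0" "v = N z *v w + g"
  shows "proj z g = v"
proof -
  have P: "is_projection_onto_along (tangent_space S z) (fast_fibre N z) (proj z)"
    using is_projection[OF assms(1)] by (simp add: slow_projection_eq[OF assms(1)])
  then have lin: "linear (proj z)"
    by (simp add: is_projection_onto_along_def)
  have "v \<in> range (proj z)"
    using P assms(2) tangent_space_eq_kernel[OF assms(1)] by (auto simp: is_projection_onto_along_def)
  then obtain u where "v = proj z u"
    by blast
  moreover have "proj z (proj z u) = proj z u" for u
    using P unfolding is_projection_onto_along_def by (metis comp_apply)
  ultimately have "proj z v = v"
    by simp
  moreover have "N z *v w \<in> {v. proj z v = 0}"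
    using P by (simp add: is_projection_onto_along_def span_columns_eq_range)
  ultimately show ?thesis
    using assms(3) linear_add[OF lin] by simp
qed

text \<open>
  The derivative at \<open>(z, 0)\<close> of an arbitrary differentiable extension \<open>\<eta>\<close> of \<open>H\<close> is determined by
  \<open>H\<close>: in the space directions because \<open>\<eta>\<close> and \<open>H\<close> agree on an open subset of the slice \<open>\<epsilon> = 0\<close>,
  in the parameter direction because one-sided derivatives are unique.
\<close>

lemma extension_derivative_space:
  assumes z: "z \<in> Sn" and \<eta>: "(\<eta> has_derivative D) (at (z, 0))" "open U" "(z, 0) \<in> U"
    "\<And>z \<epsilon>. (z, \<epsilon>) \<in> U \<Longrightarrow> 0 \<le> \<epsilon> \<Longrightarrow> \<epsilon> < \<epsilon>0 \<Longrightarrow> \<eta> (z, \<epsilon>) = H z \<epsilon>"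
  shows "D (u, 0) = u + N z *v (Df z *v u)"
proof -
  have der: "((\<lambda>w. \<eta> (w, 0)) has_derivative (\<lambda>u. D (u, 0))) (at z)"
    by (rule has_derivative_compose[where g = \<eta> and f = "\<lambda>w. (w, 0)"])
       (use \<eta>(1) in \<open>auto intro!: derivative_eq_intros\<close>)
  have op: "open ((\<lambda>w. (w, 0 :: real)) -` U)"
    by (intro open_vimage \<eta>(2) continuous_intros)
  have "((\<lambda>w. H w 0) has_derivative (\<lambda>u. D (u, 0))) (at z)"
    by (rule has_derivative_transform_within_open[OF der op]) (use \<eta>(3,4) \<epsilon>0 in auto)
  then show ?thesis
    using has_derivative_unique[OF _ H_derivative[OF z]] by metis
qed

lemma extension_derivative_parameter:
  assumes \<eta>: "(\<eta> has_derivative D) (at (z, 0))" "open U" "(z, 0) \<in> U"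
    "\<And>z \<epsilon>. (z, \<epsilon>) \<in> U \<Longrightarrow> 0 \<le> \<epsilon> \<Longrightarrow> \<epsilon> < \<epsilon>0 \<Longrightarrow> \<eta> (z, \<epsilon>) = H z \<epsilon>"
  shows "D (0, 1) = G z 0"
proof -
  let ?T = "{0..\<epsilon>0 / 2}"
  have "((\<lambda>s. \<eta> (z, s)) has_derivative (\<lambda>s. D (0, s))) (at 0 within ?T)"
    by (rule has_derivative_compose[where g = \<eta> and f = "\<lambda>s. (z, s)"])
       (use \<eta>(1) in \<open>auto intro!: derivative_eq_intros\<close>)
  moreover have "\<forall>\<^sub>F s in at 0 within ?T. \<eta> (z, s) = H z s"
  proof -
    have "open ((\<lambda>s :: real. (z, s)) -` U)"
      by (intro open_vimage \<eta>(2) continuous_intros)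
    then have "\<forall>\<^sub>F s in nhds 0. (z, s) \<in> U"
      using \<eta>(3) by (auto simp: eventually_nhds)
    then show ?thesis
      unfolding eventually_at_filter by eventually_elim (use \<epsilon>0 in \<open>auto intro: \<eta>(4)\<close>)
  qed
  ultimately have "((\<lambda>s. H z s) has_derivative (\<lambda>s. D (0, s))) (at 0 within ?T)"
    by (rule has_derivative_transform_eventually) (use \<eta>(3,4) \<epsilon>0 in auto)
  moreover have "(\<lambda>s. D (0, s)) = (\<lambda>s. s *\<^sub>R D (0, 1))"
  proof
    show "D (0, s) = s *\<^sub>R D (0, 1)" for s
      using linear_cmul[OF has_derivative_linear[OF \<eta>(1)], of s "(0, 1)"] by simp
  qed
  ultimately have 1: "((\<lambda>s. H z s) has_vector_derivative D (0, 1)) (at 0 within ?T)"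
    unfolding has_vector_derivative_def by (simp only:)
  have "continuous_on (UNIV \<times> {0..<\<epsilon>0}) (\<lambda>(z, \<epsilon>). G z \<epsilon>)"
    using smooth by (simp only: fs_smooth_def)
  then have "continuous_on ?T (\<lambda>s. (\<lambda>(z, \<epsilon>). G z \<epsilon>) (z, s))"
    by (rule continuous_on_compose2) (use \<epsilon>0 in \<open>auto intro!: continuous_intros\<close>)
  then have "continuous_on ?T (G z)"
    by simp
  then have "continuous (at 0 within ?T) (G z)"
    using \<epsilon>0 by (simp add: continuous_on_eq_continuous_within)
  then have 2: "((\<lambda>s. H z s) has_vector_derivative G z 0) (at 0 within ?T)"
    unfolding fs_map_def by (rule has_vector_derivative_scaleR_continuous)
  show ?thesis
    using \<epsilon>0 by (intro vector_derivative_unique_within[OF _ 1 2])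
      (simp add: at_within_Icc_at_right)
qed

lemma displacement_bound:
  obtains K where "0 \<le> K" "\<And>z \<epsilon>. z \<in> Sn \<Longrightarrow> 0 \<le> \<epsilon> \<Longrightarrow> \<epsilon> < \<epsilon>0 \<Longrightarrow> norm (\<Phi> z \<epsilon> - z) \<le> K * \<epsilon>"
proof -
  obtain K where K: "\<And>z \<epsilon>. z \<in> Sn \<Longrightarrow> 0 \<le> \<epsilon> \<Longrightarrow> \<epsilon> < \<epsilon>0 \<Longrightarrow> norm (\<Phi> z \<epsilon> - z) \<le> K * \<epsilon>"
    using slow unfolding slow_manifold_def by (metis atLeastLessThan_iff)
  show thesis
  proof (rule that[of "max 0 K"])
    fix z \<epsilon> assume z: "z \<in> Sn" "0 \<le> \<epsilon>" "\<epsilon> < \<epsilon>0"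
    then have "K * \<epsilon> \<le> max 0 K * \<epsilon>"
      by (intro mult_right_mono) auto
    then show "norm (\<Phi> z \<epsilon> - z) \<le> max 0 K * \<epsilon>"
      using K[OF z] by linarith
  qed simp
qed

text \<open>
  The two bounds that are passed through the compactness argument together: the error of the expansion
  at \<open>y\<close>, and the Lipschitz bound for the projected vector field. The second one is needed to change
  the base point in graph coordinates.
\<close>

definition drift_estimate :: "real \<Rightarrow> real \<Rightarrow> real^'n \<Rightarrow> real^'n \<Rightarrow> bool" where
  "drift_estimate C \<epsilon> y z \<longleftrightarrow>
     norm (H (\<Phi> y \<epsilon>) \<epsilon> - (\<Phi> y \<epsilon> + \<epsilon> *\<^sub>R proj y (G y 0))) \<le> C * \<epsilon>\<^sup>2 \<and>
     norm (proj y (G y 0) - proj z (G z 0)) \<le> C * norm (y - z)"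

text \<open>
  On \<open>S\<^sub>n\<close> near \<open>z0\<close> the drift equals the projected vector field, so the expansions and Lipschitz bounds
  for the drift become statements about \<open>\<Pi> G\<close>.
\<close>

lemma local_bounds:
  assumes z0: "z0 \<in> Sn"
  shows "\<exists>\<delta> C. 0 < \<delta> \<and> (\<forall>y\<in>Sn \<inter> ball z0 \<delta>. \<forall>z\<in>Sn \<inter> ball z0 \<delta>. \<forall>\<epsilon>\<in>{0..<\<delta>}.
    drift_estimate C \<epsilon> y z)"
proof -
  have "\<exists>U h. open U \<and> (z0, 0) \<in> U \<and> C_diff r h U \<and>
      (\<forall>y\<in>UNIV \<times> {0..<\<epsilon>0} \<inter> U. h y = (case y of (z, \<epsilon>) \<Rightarrow> H z \<epsilon>))"
    using smooth \<epsilon>0 by (auto simp: fs_smooth_def C_diff_on_def)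
  then obtain U \<eta> where U: "open U" "(z0, 0) \<in> U" and \<eta>r: "C_diff r \<eta> U"
    and \<eta>H: "\<And>z \<epsilon>. (z, \<epsilon>) \<in> U \<Longrightarrow> 0 \<le> \<epsilon> \<Longrightarrow> \<epsilon> < \<epsilon>0 \<Longrightarrow> \<eta> (z, \<epsilon>) = H z \<epsilon>"
    by force
  have "\<exists>U h. open U \<and> (z0, 0) \<in> U \<and> C_diff r h U \<and>
      (\<forall>y\<in>Sn \<times> {0..<\<epsilon>0} \<inter> U. h y = (case y of (z, \<epsilon>) \<Rightarrow> \<Phi> z \<epsilon>))"
    using slow \<epsilon>0 z0 by (auto simp: slow_manifold_def C_diff_on_def)
  then obtain W h where W: "open W" "(z0, 0) \<in> W" and hr: "C_diff r h W"
    and h\<Phi>: "\<And>z \<epsilon>. z \<in> Sn \<Longrightarrow> (z, \<epsilon>) \<in> W \<Longrightarrow> 0 \<le> \<epsilon> \<Longrightarrow> \<epsilon> < \<epsilon>0 \<Longrightarrow> h (z, \<epsilon>) = \<Phi> z \<epsilon>"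
    by force
  obtain K where K: "0 \<le> K" "\<And>z \<epsilon>. z \<in> Sn \<Longrightarrow> 0 \<le> \<epsilon> \<Longrightarrow> \<epsilon> < \<epsilon>0 \<Longrightarrow> norm (\<Phi> z \<epsilon> - z) \<le> K * \<epsilon>"
    using displacement_bound by blast
  interpret slow_family H \<Phi> Sn \<epsilon>0 K \<eta> h U W z0
  proof
    show "C_diff 2 \<eta> U" "C_diff 2 h W"
      using C_diff_le[OF \<eta>r r] C_diff_le[OF hr r] .
    show "\<Phi> z 0 = z" if "z \<in> Sn" for z
      using slow that by (simp add: slow_manifold_def)
  qed (fact \<epsilon>0 U \<eta>H W h\<Phi> H_fixed K | assumption)+
  obtain \<delta> C where \<delta>: "0 < \<delta>" "\<delta> \<le> \<epsilon>0" and C: "0 \<le> C"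
    and U\<delta>: "\<And>z. z \<in> ball z0 \<delta> \<Longrightarrow> (z, 0) \<in> U"
    and \<Phi>_exp: "\<And>z \<epsilon>. z \<in> Sn \<Longrightarrow> z \<in> ball z0 \<delta> \<Longrightarrow> 0 \<le> \<epsilon> \<Longrightarrow> \<epsilon> < \<delta> \<Longrightarrow>
       norm (\<Phi> z \<epsilon> - z - \<epsilon> *\<^sub>R shift z) \<le> C * \<epsilon>\<^sup>2"
    and H_exp: "\<And>z \<epsilon>. z \<in> Sn \<Longrightarrow> z \<in> ball z0 \<delta> \<Longrightarrow> 0 \<le> \<epsilon> \<Longrightarrow> \<epsilon> < \<delta> \<Longrightarrow>
       norm (H (\<Phi> z \<epsilon>) \<epsilon> - \<Phi> z \<epsilon> - \<epsilon> *\<^sub>R drift z) \<le> C * \<epsilon>\<^sup>2"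
    and shift_lip: "\<And>z w. z \<in> ball z0 \<delta> \<Longrightarrow> w \<in> ball z0 \<delta> \<Longrightarrow> norm (shift z - shift w) \<le> C * norm (z - w)"
    and drift_lip: "\<And>z w. z \<in> ball z0 \<delta> \<Longrightarrow> w \<in> ball z0 \<delta> \<Longrightarrow> norm (drift z - drift w) \<le> C * norm (z - w)"
    by (rule expansions) (rule that)
  let ?I = "top_of_set S interior_of Sn"
  have I_sub: "?I \<subseteq> Sn"
    by (rule interior_of_subset)
  have ker_I: "frechet_derivative f (at z) (drift z) = 0" if zI: "z \<in> ?I" and zb: "z \<in> ball z0 \<delta>" for z
  proof -
    have zS: "z \<in> Sn"
      using zI I_sub by blast
    obtain d where d: "0 < d"
      and inv: "\<And>\<epsilon> y. 0 \<le> \<epsilon> \<Longrightarrow> \<epsilon> < \<epsilon>0 \<Longrightarrow> \<epsilon> < d \<Longrightarrow> y \<in> M \<epsilon> \<Longrightarrow> dist (H y \<epsilon>) z < d \<Longrightarrow> H y \<epsilon> \<in> M \<epsilon>"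
      using slow zI unfolding slow_manifold_def locally_invariant_def by (metis atLeastLessThan_iff)
    have M: "M \<epsilon> = (\<lambda>z. \<Phi> z \<epsilon>) ` Sn" if "0 \<le> \<epsilon>" "\<epsilon> < \<epsilon>0" for \<epsilon>
      using slow that by (simp add: slow_manifold_def)
    show ?thesis
    proof (rule tangent_first_order_motion[where f = f and V = UNIV and A = Sn and s = shift and \<Phi> = \<Phi>
          and H = H and C = C and K = K and d = d and \<delta> = \<delta> and ?\<epsilon>0.0 = \<epsilon>0 and ?z0.0 = z0])
      show "norm (shift w - shift z) \<le> C * norm (w - z)" if "w \<in> ball z0 \<delta>" for w
        using shift_lip[OF that zb] .
      show "H (\<Phi> z \<epsilon>) \<epsilon> \<in> (\<lambda>z. \<Phi> z \<epsilon>) ` Sn"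
        if "0 \<le> \<epsilon>" "\<epsilon> < \<epsilon>0" "\<epsilon> < d" "dist (H (\<Phi> z \<epsilon>) \<epsilon>) z < d" for \<epsilon>
        using inv[OF that(1-3) _ that(4)] M[OF that(1,2)] zS by blast
    qed (use C2(2) zS zb C \<delta> d in \<open>auto intro: f_zero K \<Phi>_exp H_exp simp del: C_diff.simps\<close>)
  qed
  have drift_eq: "proj z (G z 0) = drift z" if z: "z \<in> Sn" "z \<in> ball z0 \<delta>" for z
  proof -
    have "frechet_derivative f (at z) (drift z) = 0"
    proof (rule kernel_condition_at_limit_point[where V = UNIV and B = ?I])
      show "norm (drift z - drift w) \<le> C * norm (z - w)" if "w \<in> ball z0 \<delta>" for w
        using drift_lip[OF z(2) that] .
      show "\<exists>w\<in>?I. dist w z < e" if "0 < e" for e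
        using rel_interior_dense_in_submanifold_bd[OF _ Sn(4) Sn(1) z(1) that] A1
        unfolding assumption_fast_slow_def by blast
    qed (use C2(2) z(2) C ker_I in auto)
    then have "Df z *v drift z = 0"
      by (simp add: Df_mult)
    moreover have "drift z = N z *v (Df z *v shift z) + G z 0"
    proof -
      note zU = U\<delta>[OF z(2)]
      have D: "(\<eta> has_derivative frechet_derivative \<eta> (at (z, 0))) (at (z, 0))"
        by (rule C_diff_has_derivative[OF \<eta>r _ zU]) (use r in simp)
      have "frechet_derivative \<eta> (at (z, 0)) (shift z, 1) =
          frechet_derivative \<eta> (at (z, 0)) (shift z, 0) + frechet_derivative \<eta> (at (z, 0)) (0, 1)"
        using linear_add[OF has_derivative_linear[OF D], of "(shift z, 0)" "(0, 1)"] by simp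
      then show ?thesis
        using extension_derivative_space[OF z(1) D U(1) zU \<eta>H]
          extension_derivative_parameter[OF D U(1) zU \<eta>H] by (simp add: drift_def)
    qed
    ultimately show ?thesis
      by (rule slow_projection_eqI[OF z(1)])
  qed
  have "drift_estimate C \<epsilon> y z"
    if "y \<in> Sn \<inter> ball z0 \<delta>" "z \<in> Sn \<inter> ball z0 \<delta>" "\<epsilon> \<in> {0..<\<delta>}" for y z \<epsilon>
    using H_exp[of y \<epsilon>] drift_lip[of y z] that
    by (simp add: drift_estimate_def drift_eq diff_diff_eq)
  then show ?thesis
    using \<delta>(1) by blast
qed

lemma uniform_bounds:
  obtains \<delta> C where "0 < \<delta>" "0 \<le> C"
    "\<And>y z \<epsilon>. y \<in> Sn \<Longrightarrow> z \<in> Sn \<Longrightarrow> dist y z < \<delta> \<Longrightarrow> 0 \<le> \<epsilon> \<Longrightarrow> \<epsilon> < \<delta> \<Longrightarrow> drift_estimate C \<epsilon> y z"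
proof -
  have mono: "drift_estimate C' \<epsilon> y z" if "drift_estimate C \<epsilon> y z" "C \<le> C'" for C C' \<epsilon> y z
  proof -
    note estimates = that(1)[unfolded drift_estimate_def]
    have "norm (H (\<Phi> y \<epsilon>) \<epsilon> - (\<Phi> y \<epsilon> + \<epsilon> *\<^sub>R proj y (G y 0))) \<le> C' * \<epsilon>\<^sup>2"
      using conjunct1[OF estimates] mult_right_mono[OF that(2) zero_le_power2[of \<epsilon>]] by linarith
    moreover have "norm (proj y (G y 0) - proj z (G z 0)) \<le> C' * norm (y - z)"
      using conjunct2[OF estimates] mult_right_mono[OF that(2) norm_ge_zero[of "y - z"]] by linarith
    ultimately show ?thesis
      unfolding drift_estimate_def by (rule conjI)
  qed
  obtain \<delta> C where "0 < \<delta>"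
    "\<And>y z \<epsilon>. y \<in> Sn \<Longrightarrow> z \<in> Sn \<Longrightarrow> dist y z < \<delta> \<Longrightarrow> \<epsilon> \<in> {0..<\<delta>} \<Longrightarrow> drift_estimate C \<epsilon> y z"
    by (rule compact_uniform_constants[where Q = drift_estimate, OF Sn(2)])
      (erule (1) mono, erule local_bounds, rule that)
  then show thesis
    by (intro that[of \<delta> "max 0 C"]) (auto intro: mono[of C])
qed

lemma slow_map_expansion:
  "\<exists>\<epsilon>1 C. 0 < \<epsilon>1 \<and> \<epsilon>1 \<le> \<epsilon>0 \<and> (\<forall>\<epsilon>\<in>{0..<\<epsilon>1}. \<forall>z\<in>Sn.
     norm (H (\<Phi> z \<epsilon>) \<epsilon> - (\<Phi> z \<epsilon> + \<epsilon> *\<^sub>R proj z (G z 0))) \<le> C * \<epsilon>\<^sup>2)"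
proof -
  obtain \<delta> C where \<delta>: "0 < \<delta>"
    and Q: "\<And>y z \<epsilon>. y \<in> Sn \<Longrightarrow> z \<in> Sn \<Longrightarrow> dist y z < \<delta> \<Longrightarrow> 0 \<le> \<epsilon> \<Longrightarrow> \<epsilon> < \<delta> \<Longrightarrow> drift_estimate C \<epsilon> y z"
    using uniform_bounds by metis
  have "norm (H (\<Phi> z \<epsilon>) \<epsilon> - (\<Phi> z \<epsilon> + \<epsilon> *\<^sub>R proj z (G z 0))) \<le> C * \<epsilon>\<^sup>2"
    if "\<epsilon> \<in> {0..<min \<epsilon>0 \<delta>}" "z \<in> Sn" for \<epsilon> z
    using Q[of z z \<epsilon>] that \<delta> by (simp add: drift_estimate_def)
  then show ?thesis
    using \<epsilon>0 \<delta> by (intro exI[of _ "min \<epsilon>0 \<delta>"] exI[of _ C]) auto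
qed

text \<open>
  The point of \<open>M \<epsilon>\<close> over \<open>x\<close> and the base point over \<open>x\<close> have the same first coordinate, but the former
  is \<open>\<Phi> w \<epsilon>\<close> with \<open>w\<close> in general different from \<open>z\<close>. Since \<open>w - z = O(\<epsilon>)\<close> and the projected vector
  field is Lipschitz, replacing \<open>w\<close> by \<open>z\<close> in the factor of \<open>\<epsilon>\<close> costs only \<open>O(\<epsilon>\<^sup>2)\<close>.
\<close>

lemma slow_map_expansion_graph:
  fixes L :: "real^'n \<Rightarrow> (real^'k) \<times> (real^'m)"
  assumes \<delta>0: "0 < \<delta>0" "\<delta>0 \<le> \<epsilon>0" and graph: "graph_coordinates f Sn M \<delta>0 L W D \<phi>"
  shows "\<exists>\<epsilon>1 C. 0 < \<epsilon>1 \<and> \<epsilon>1 \<le> \<delta>0 \<and> (\<forall>\<epsilon>\<in>{0..<\<epsilon>1}. \<forall>x\<in>D.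
    let z = inv L (x, \<phi> 0 x); z\<epsilon> = inv L (x, \<phi> \<epsilon> x) in
      norm (H z\<epsilon> \<epsilon> - (z\<epsilon> + \<epsilon> *\<^sub>R proj z (G z 0))) \<le> C * \<epsilon>\<^sup>2)"
proof -
  note graph = graph[unfolded graph_coordinates_def]
  have L: "linear L" "bij L" and Sn_graph: "L ` (Sn \<inter> W) = {(x, \<phi> 0 x) | x. x \<in> D}"
    and M_graph: "\<forall>\<epsilon>\<in>{0..<\<delta>0}. L ` (M \<epsilon> \<inter> W) = {(x, \<phi> \<epsilon> x) | x. x \<in> D}"
    and "\<exists>K. \<forall>\<epsilon>\<in>{0..<\<delta>0}. \<forall>x\<in>D. norm (\<phi> \<epsilon> x - \<phi> 0 x) \<le> K * \<epsilon>"
    using graph by blast+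
  then obtain K\<phi> where K\<phi>: "\<forall>\<epsilon>\<in>{0..<\<delta>0}. \<forall>x\<in>D. norm (\<phi> \<epsilon> x - \<phi> 0 x) \<le> K\<phi> * \<epsilon>"
    by blast
  obtain K where K: "0 \<le> K" "\<And>z \<epsilon>. z \<in> Sn \<Longrightarrow> 0 \<le> \<epsilon> \<Longrightarrow> \<epsilon> < \<epsilon>0 \<Longrightarrow> norm (\<Phi> z \<epsilon> - z) \<le> K * \<epsilon>"
    using displacement_bound by blast
  have lin: "linear (inv L)"
    by (rule linear_inv_of_bij[OF L])
  obtain B where B: "0 < B" "\<And>v. norm (inv L v) \<le> B * norm v"
    using linear_bounded_pos[OF lin] by blast
  obtain \<delta> C where \<delta>: "0 < \<delta>" and C: "0 \<le> C"
    and Q: "\<And>y z \<epsilon>. y \<in> Sn \<Longrightarrow> z \<in> Sn \<Longrightarrow> dist y z < \<delta> \<Longrightarrow> 0 \<le> \<epsilon> \<Longrightarrow> \<epsilon> < \<delta> \<Longrightarrow> drift_estimate C \<epsilon> y z"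
    using uniform_bounds by metis
  define K' where "K' = K + B * \<bar>K\<phi>\<bar>"
  define \<epsilon>1 where "\<epsilon>1 = min \<delta>0 (min \<delta> (\<delta> / (K' + 1)))"
  have K': "0 \<le> K'"
    using K(1) B(1) by (simp add: K'_def)
  have \<epsilon>1: "0 < \<epsilon>1" "\<epsilon>1 \<le> \<delta>0" "\<epsilon>1 \<le> \<delta>" "\<epsilon>1 \<le> \<delta> / (K' + 1)"
    using \<delta>0 \<delta> K' by (auto simp: \<epsilon>1_def)
  have "norm (H z\<epsilon> \<epsilon> - (z\<epsilon> + \<epsilon> *\<^sub>R proj z (G z 0))) \<le> (C + C * K') * \<epsilon>\<^sup>2"
    if \<epsilon>: "\<epsilon> \<in> {0..<\<epsilon>1}" and x: "x \<in> D"
      and z: "z = inv L (x, \<phi> 0 x)" and z\<epsilon>: "z\<epsilon> = inv L (x, \<phi> \<epsilon> x)" for \<epsilon> x z z\<epsilon>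
  proof -
    have \<epsilon>': "0 \<le> \<epsilon>" "\<epsilon> < \<delta>0" "\<epsilon> < \<delta>" "\<epsilon> < \<epsilon>0"
      using \<epsilon> \<epsilon>1 \<delta>0 by auto
    have \<epsilon>_in: "\<epsilon> \<in> {0..<\<delta>0}"
      using \<epsilon>'(1,2) by simp
    have "(x, \<phi> 0 x) \<in> L ` (Sn \<inter> W)" "(x, \<phi> \<epsilon> x) \<in> L ` (M \<epsilon> \<inter> W)"
      unfolding Sn_graph bspec[OF M_graph \<epsilon>_in] using x by blast+
    then have zS: "z \<in> Sn" and "z\<epsilon> \<in> M \<epsilon>"
      using L(2) by (auto simp: z z\<epsilon> bij_is_inj)
    moreover have "M \<epsilon> = (\<lambda>z. \<Phi> z \<epsilon>) ` Sn"
      using slow \<epsilon>'(1,4) by (simp add: slow_manifold_def)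
    ultimately obtain w where w: "w \<in> Sn" "z\<epsilon> = \<Phi> w \<epsilon>"
      by blast
    have "z\<epsilon> - z = inv L (0, \<phi> \<epsilon> x - \<phi> 0 x)"
      using linear_diff[OF lin, of "(x, \<phi> \<epsilon> x)" "(x, \<phi> 0 x)"] by (simp add: z z\<epsilon>)
    then have "norm (z\<epsilon> - z) \<le> B * norm (\<phi> \<epsilon> x - \<phi> 0 x)"
      using B(2)[of "(0, \<phi> \<epsilon> x - \<phi> 0 x)"] by (simp add: norm_Pair)
    also have "norm (\<phi> \<epsilon> x - \<phi> 0 x) \<le> \<bar>K\<phi>\<bar> * \<epsilon>"
      using bspec[OF bspec[OF K\<phi> \<epsilon>_in] x] mult_right_mono[OF abs_ge_self[of K\<phi>] \<epsilon>'(1)] by linarith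
    finally have "norm (z\<epsilon> - z) \<le> B * \<bar>K\<phi>\<bar> * \<epsilon>"
      using B(1) by (simp add: mult.assoc)
    moreover have "norm (w - z) \<le> norm (z\<epsilon> - w) + norm (z\<epsilon> - z)"
      using norm_triangle_ineq4[of "z\<epsilon> - z" "z\<epsilon> - w"] by simp
    ultimately have wz: "norm (w - z) \<le> K' * \<epsilon>"
      using K(2)[OF w(1) \<epsilon>'(1,4)] by (simp add: w(2) K'_def algebra_simps)
    have "\<epsilon> < \<delta> / (K' + 1)"
      using \<epsilon> \<epsilon>1(4) by simp
    then have "(K' + 1) * \<epsilon> < \<delta>"
      using K' by (simp add: pos_less_divide_eq mult.commute)
    then have "dist w z < \<delta>"
      using wz \<epsilon>'(1) by (simp add: dist_norm algebra_simps)
    then have "drift_estimate C \<epsilon> w z"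
      using Q w(1) zS \<epsilon>'(1,3) by blast
    then have 1: "norm (H z\<epsilon> \<epsilon> - (z\<epsilon> + \<epsilon> *\<^sub>R proj w (G w 0))) \<le> C * \<epsilon>\<^sup>2"
      and 2: "norm (proj w (G w 0) - proj z (G z 0)) \<le> C * norm (w - z)"
      by (simp_all add: drift_estimate_def w(2))
    have "norm (proj w (G w 0) - proj z (G z 0)) \<le> C * (K' * \<epsilon>)"
      using 2 mult_left_mono[OF wz C] by linarith
    then have "\<epsilon> * norm (proj w (G w 0) - proj z (G z 0)) \<le> \<epsilon> * (C * (K' * \<epsilon>))"
      using \<epsilon>'(1) by (rule mult_left_mono)
    then have 3: "norm (\<epsilon> *\<^sub>R (proj w (G w 0) - proj z (G z 0))) \<le> C * K' * \<epsilon>\<^sup>2"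
      using \<epsilon>'(1) by (simp add: power2_eq_square ac_simps)
    have "H z\<epsilon> \<epsilon> - (z\<epsilon> + \<epsilon> *\<^sub>R proj z (G z 0)) = (H z\<epsilon> \<epsilon> - (z\<epsilon> + \<epsilon> *\<^sub>R proj w (G w 0)))
        + \<epsilon> *\<^sub>R (proj w (G w 0) - proj z (G z 0))"
      by (simp add: algebra_simps)
    then have "norm (H z\<epsilon> \<epsilon> - (z\<epsilon> + \<epsilon> *\<^sub>R proj z (G z 0))) \<le> C * \<epsilon>\<^sup>2 + C * K' * \<epsilon>\<^sup>2"
      using norm_triangle_mono[OF 1 3] by (simp only:)
    then show ?thesis
      by (simp add: algebra_simps)
  qed
  then show ?thesis
    using \<epsilon>1(1,2) unfolding Let_def by blast
qed

lemma slow_projection_matrix: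
  assumes "z \<in> Sn"
  shows "matrix (proj z) = mat 1 - N z ** matrix_inv (Df z ** N z) ** Df z"
  by (simp add: slow_projection_eq[OF assms])

end

theorem proposition2p14:
  fixes N :: "real^'n \<Rightarrow> real^'m^'n"
    and f :: "real^'n \<Rightarrow> real^'m"
    and G :: "real^'n \<Rightarrow> real \<Rightarrow> real^'n"
    and S Sn :: "(real^'n) set"
    and M :: "real \<Rightarrow> (real^'n) set"
    and \<Phi> :: "real^'n \<Rightarrow> real \<Rightarrow> real^'n"
    and \<epsilon>0 :: real and r :: nat
  defines "H \<equiv> fs_map N f G"
  assumes dims: "CARD('n) = CARD('k::finite) + CARD('m)"
    and r: "2 \<le> r" and \<epsilon>0: "0 < \<epsilon>0"
    and smooth: "fs_smooth r \<epsilon>0 N f G"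
    and A1: "assumption_fast_slow r CARD('k) N f S"
    and A2: "assumption_factorisation N f S"
    and Sn: "Sn \<subseteq> S" "compact Sn" "connected Sn" "embedded_submanifold_bd r CARD('k) Sn"
    and nh: "normally_hyperbolic CARD('k) H S Sn"
    and slow: "slow_manifold r H S Sn \<epsilon>0 \<Phi> M"
  shows "(\<forall>z\<in>Sn. \<exists>!P. is_projection_onto_along (tangent_space S z) (fast_fibre N z) P) \<and>
    (\<exists>\<epsilon>1 C. 0 < \<epsilon>1 \<and> \<epsilon>1 \<le> \<epsilon>0 \<and> (\<forall>\<epsilon>\<in>{0..<\<epsilon>1}. \<forall>z\<in>Sn.
       norm (H (\<Phi> z \<epsilon>) \<epsilon> - (\<Phi> z \<epsilon> + \<epsilon> *\<^sub>R slow_projection N S z (G z 0))) \<le> C * \<epsilon>\<^sup>2)) \<and>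
    (\<forall>(L :: real^'n \<Rightarrow> (real^'k) \<times> (real^'m)) W D \<phi> \<delta>.
       0 < \<delta> \<and> \<delta> \<le> \<epsilon>0 \<and> graph_coordinates f Sn M \<delta> L W D \<phi> \<longrightarrow>
       (\<exists>\<epsilon>1 C. 0 < \<epsilon>1 \<and> \<epsilon>1 \<le> \<delta> \<and> (\<forall>\<epsilon>\<in>{0..<\<epsilon>1}. \<forall>x\<in>D.
          let z = inv L (x, \<phi> 0 x); z\<epsilon> = inv L (x, \<phi> \<epsilon> x) in
          norm (H z\<epsilon> \<epsilon> - (z\<epsilon> + \<epsilon> *\<^sub>R slow_projection N S z (G z 0))) \<le> C * \<epsilon>\<^sup>2))) \<and>
    (\<forall>z\<in>Sn. let Df = jacobian f (at z) in
       invertible (Df ** N z) \<and>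
       matrix (slow_projection N S z) = mat 1 - N z ** matrix_inv (Df ** N z) ** Df)"
proof -
  interpret fast_slow_system N f G S Sn M \<Phi> \<epsilon>0 r "CARD('k)"
    using dims r \<epsilon>0 smooth A1 A2 Sn nh slow unfolding H_def by unfold_locales
  show ?thesis
    unfolding H_def
  proof (intro conjI ballI allI impI)
    show "\<exists>!P. is_projection_onto_along (tangent_space S z) (fast_fibre N z) P" if "z \<in> Sn" for z
      by (rule unique_projection[OF that])
    show "\<exists>\<epsilon>1 C. 0 < \<epsilon>1 \<and> \<epsilon>1 \<le> \<epsilon>0 \<and> (\<forall>\<epsilon>\<in>{0..<\<epsilon>1}. \<forall>z\<in>Sn.
        norm (fs_map N f G (\<Phi> z \<epsilon>) \<epsilon> - (\<Phi> z \<epsilon> + \<epsilon> *\<^sub>R slow_projection N S z (G z 0))) \<le> C * \<epsilon>\<^sup>2)"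
      by (rule slow_map_expansion)
    show "\<exists>\<epsilon>1 C. 0 < \<epsilon>1 \<and> \<epsilon>1 \<le> \<delta> \<and> (\<forall>\<epsilon>\<in>{0..<\<epsilon>1}. \<forall>x\<in>D.
        let z = inv L (x, \<phi> 0 x); z\<epsilon> = inv L (x, \<phi> \<epsilon> x) in
          norm (fs_map N f G z\<epsilon> \<epsilon> - (z\<epsilon> + \<epsilon> *\<^sub>R slow_projection N S z (G z 0))) \<le> C * \<epsilon>\<^sup>2)"
      if "0 < \<delta> \<and> \<delta> \<le> \<epsilon>0 \<and> graph_coordinates f Sn M \<delta> L W D \<phi>"
      for L :: "real^'n \<Rightarrow> (real^'k) \<times> (real^'m)" and W D \<phi> \<delta>
      using that slow_map_expansion_graph by blast
    show "let Df = jacobian f (at z) in invertible (Df ** N z) \<and>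
        matrix (slow_projection N S z) = mat 1 - N z ** matrix_inv (Df ** N z) ** Df" if "z \<in> Sn" for z
      using invertible_Df_N[OF that] slow_projection_matrix[OF that] by (simp add: Let_def)
  qed
qed

end
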